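(* Let $\Bbbk$ be a field, let $\Delta$ be a finite simplicial complex on $[m]=\{1,\dots,m\}$ without ghost vertices, let $n_1,\dots,n_m\ge 2$ be integers, and let $G=\Delta^{(1)}$ be the $1$-skeleton of $\Delta$. Put $A_{\Delta,\mathbf n}=\Bbbk[x_1,\dots,x_m]/\bigl(I_\Delta+(x_1^{n_1},\dots,x_m^{n_m})\bigr)$. Then $A_{\Delta,\mathbf n}$ is nearly Gorenstein if and only if every connected component $C$ of $G$ (identified with its vertex set) satisfies one of the following: (i) $\Delta|_C=2^C$; (ii) $\Delta|_C=\partial 2^C$ and $n_i=2$ for every $i\in C$.
   Context: A simplicial complex $\Delta$ on $[m]$ is a set of subsets (faces) of $[m]$ closed under taking subsets and containing $\varnothing$. A vertex $i$ is a ghost vertex if $\{i\}\notin\Delta$. For $F\subseteq[m]$ put $x_F=\prod_{i\in F}x_i$; $I_\Delta=(x_F: F\subseteq[m],\ F\notin\Delta)$ is the Stanley--Reisner ideal. For $C\subseteq[m]$, $\Delta|_C=\{F\in\Delta:F\subseteq C\}$ is the induced subcomplex, $2^C$ is the full simplex (all subsets of $C$), and $\partial2^C=\{F:F\subsetneq C\}$ is its boundary. The $1$-skeleton $\Delta^{(1)}$ is the graph on the non-ghost vertices whose edges are the two-element faces of $\Delta$. For an Artinian positively graded $\Bbbk$-algebra $A$ (with $A_0=\Bbbk$), with graded maximal ideal $\mathfrak m_A$, the canonical module is $\omega_A=\operatorname{Hom}_{\Bbbk}(A,\Bbbk)$ with $(a\lambda)(b)=\lambda(ab)$, and the canonical trace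 is the ideal $\operatorname{tr}_A(\omega_A)=\sum_{\varphi\in\operatorname{Hom}_A(\omega_A,A)}\varphi(\omega_A)$. The algebra $A$ is nearly Gorenstein if $\mathfrak m_A\subseteq\operatorname{tr}_A(\omega_A)$ (Gorenstein algebras are included). *)

theory Defs
  imports
    "HOL-Algebra.QuotRing"
    "HOL-Algebra.Module"
    "HOL-Library.Poly_Mapping"
    "HOL-Library.FuncSet"
begin

section \<open>Simplicial complexes\<close>

definition simplicial_complex :: "nat \<Rightarrow> nat set set \<Rightarrow> bool" where
  "simplicial_complex m \<Delta> \<longleftrightarrow>
     \<Delta> \<subseteq> Pow {1..m} \<and> {} \<in> \<Delta> \<and> (\<forall>F\<in>\<Delta>. \<forall>F'. F' \<subseteq> F \<longrightarrow> F' \<in> \<Delta>)"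

definition ghost_vertex :: "nat \<Rightarrow> nat set set \<Rightarrow> nat \<Rightarrow> bool" where
  "ghost_vertex m \<Delta> i \<longleftrightarrow> i \<in> {1..m} \<and> {i} \<notin> \<Delta>"

definition induced_subcomplex :: "nat set set \<Rightarrow> nat set \<Rightarrow> nat set set" where
  "induced_subcomplex \<Delta> C = {F \<in> \<Delta>. F \<subseteq> C}"

definition full_simplex :: "nat set \<Rightarrow> nat set set" where
  "full_simplex C = Pow C"

definition boundary_simplex :: "nat set \<Rightarrow> nat set set" where
  "boundary_simplex C = {F. F \<subset> C}"

text \<open>A simple graph is a pair of its vertex set and its set of two-element edges.\<close>

definition one_skeleton :: "nat \<Rightarrow> nat set set \<Rightarrow> nat set \<times> nat set set" where
  "one_skeleton m \<Delta> =
     ({i \<in> {1..m}. \<not> ghost_vertex m \<Delta> i}, {e \<in> \<Delta>. card e = 2})"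

definition connected_components :: "'v set \<times> 'v set set \<Rightarrow> 'v set set" where
  "connected_components G =
     fst G // {(u, v) \<in> fst G \<times> fst G. (u, v) \<in> {(a, b). {a, b} \<in> snd G}\<^sup>*}"


section \<open>Polynomial rings\<close>

text \<open>A polynomial in indeterminates indexed by \<^typ>\<open>nat\<close> is a finitely supported function
  from exponent vectors to coefficients; the type carries the usual convolution product.
  The ring \<open>k[x\<^sub>i : i \<in> V]\<close> consists of those in which only the indeterminates from
  \<open>V\<close> occur.\<close>

type_synonym 'k mpol = "(nat \<Rightarrow>\<^sub>0 nat) \<Rightarrow>\<^sub>0 'k"

definition Var :: "nat \<Rightarrow> 'k::field mpol" where
  "Var i = Poly_Mapping.single (Poly_Mapping.single i 1) 1"

definition Const :: "'k \<Rightarrow> 'k::field mpol" where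
  "Const c = Poly_Mapping.single 0 c"

definition poly_ring :: "nat set \<Rightarrow> 'k::field mpol ring" where
  "poly_ring V =
     \<lparr>carrier = {p. \<forall>t \<in> Poly_Mapping.keys p. Poly_Mapping.keys t \<subseteq> V},
      mult = (*), one = 1, zero = 0, add = (+)\<rparr>"

definition monom_degree :: "(nat \<Rightarrow>\<^sub>0 nat) \<Rightarrow> nat" where
  "monom_degree t = (\<Sum>i\<in>Poly_Mapping.keys t. Poly_Mapping.lookup t i)"

definition homogeneous :: "nat \<Rightarrow> 'k::field mpol \<Rightarrow> bool" where
  "homogeneous d p \<longleftrightarrow> (\<forall>t \<in> Poly_Mapping.keys p. monom_degree t = d)"


section \<open>The algebra $A_{\Delta,\mathbf n}$\<close>

definition stanley_reisner_ideal :: "nat \<Rightarrow> nat set set \<Rightarrow> 'k::field mpol set" where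
  "stanley_reisner_ideal m \<Delta> =
     Idl\<^bsub>poly_ring {1..m}\<^esub> {\<Prod>i\<in>F. Var i |F. F \<subseteq> {1..m} \<and> F \<notin> \<Delta>}"

definition pure_power_ideal :: "nat \<Rightarrow> (nat \<Rightarrow> nat) \<Rightarrow> 'k::field mpol set" where
  "pure_power_ideal m n = Idl\<^bsub>poly_ring {1..m}\<^esub> {Var i ^ n i |i. i \<in> {1..m}}"

definition defining_ideal :: "nat \<Rightarrow> nat set set \<Rightarrow> (nat \<Rightarrow> nat) \<Rightarrow> 'k::field mpol set" where
  "defining_ideal m \<Delta> n =
     stanley_reisner_ideal m \<Delta> <+>\<^bsub>poly_ring {1..m}\<^esub> pure_power_ideal m n"

text \<open>Algebras over a field type \<^typ>\<open>'k\<close> are elements of the record type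
  \<^typ>\<open>('k, 'a) module\<close>, which contains both the ring operations and the scalar
  multiplication by \<^typ>\<open>'k\<close>.\<close>

definition A_alg :: "nat \<Rightarrow> nat set set \<Rightarrow> (nat \<Rightarrow> nat) \<Rightarrow> ('k::field, 'k mpol set) module" where
  "A_alg m \<Delta> n =
     (let R = poly_ring {1..m}; I = defining_ideal m \<Delta> n
      in ring.extend (R Quot I)
           (module.fields (\<lambda>c X. (I +>\<^bsub>R\<^esub> Const c) \<otimes>\<^bsub>R Quot I\<^esub> X)))"

text \<open>The standard grading, in which every indeterminate has degree one.\<close>

definition A_grading ::
    "nat \<Rightarrow> nat set set \<Rightarrow> (nat \<Rightarrow> nat) \<Rightarrow> nat \<Rightarrow> 'k::field mpol set set" where
  "A_grading m \<Delta> n d =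
     (\<lambda>p. defining_ideal m \<Delta> n +>\<^bsub>poly_ring {1..m}\<^esub> p)
       ` {p \<in> carrier (poly_ring {1..m}). homogeneous d p}"


section \<open>Canonical trace and nearly Gorenstein algebras\<close>

text \<open>\<open>Hom\<^sub>k(A, k)\<close> as an \<open>A\<close>-module. Linear forms are functions on the carrier of
  \<open>A\<close>, hence taken extensional. The ring multiplication and unit, which the record type
  provides, play no role for a module and are left unspecified.\<close>

definition canonical_module :: "('k::field, 'a) module \<Rightarrow> ('a, 'a \<Rightarrow> 'k) module" where
  "canonical_module A =
     \<lparr>carrier = {f \<in> carrier A \<rightarrow>\<^sub>E UNIV.
         (\<forall>a\<in>carrier A. \<forall>b\<in>carrier A. f (a \<oplus>\<^bsub>A\<^esub> b) = f a + f b) \<and>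
         (\<forall>c. \<forall>a\<in>carrier A. f (c \<odot>\<^bsub>A\<^esub> a) = c * f a)},
      mult = undefined, one = undefined,
      zero = (\<lambda>b\<in>carrier A. 0),
      add = (\<lambda>f g. \<lambda>b\<in>carrier A. f b + g b),
      smult = (\<lambda>a f. \<lambda>b\<in>carrier A. f (a \<otimes>\<^bsub>A\<^esub> b))\<rparr>"

definition regular_module :: "('a, 'r) ring_scheme \<Rightarrow> ('a, 'a) module" where
  "regular_module R =
     \<lparr>carrier = carrier R, mult = mult R, one = \<one>\<^bsub>R\<^esub>, zero = \<zero>\<^bsub>R\<^esub>, add = add R,
      smult = mult R\<rparr>"

definition module_homs ::
    "('a, 'r) ring_scheme \<Rightarrow> ('a, 'b, 's) module_scheme \<Rightarrow> ('a, 'c, 't) module_scheme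
      \<Rightarrow> ('b \<Rightarrow> 'c) set" where
  "module_homs R M N = {\<phi> \<in> carrier M \<rightarrow> carrier N.
     (\<forall>x\<in>carrier M. \<forall>y\<in>carrier M. \<phi> (x \<oplus>\<^bsub>M\<^esub> y) = \<phi> x \<oplus>\<^bsub>N\<^esub> \<phi> y) \<and>
     (\<forall>a\<in>carrier R. \<forall>x\<in>carrier M. \<phi> (a \<odot>\<^bsub>M\<^esub> x) = a \<odot>\<^bsub>N\<^esub> \<phi> x)}"

text \<open>The sum of the images of all homomorphisms, that is, the set of all finite sums of
  elements of the images.\<close>

definition canonical_trace :: "('k::field, 'a) module \<Rightarrow> 'a set" where
  "canonical_trace A =
     {(\<Oplus>\<^bsub>A\<^esub>\<phi>\<in>\<Phi>. \<phi> (s \<phi>)) |\<Phi> s.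
        finite \<Phi> \<and> \<Phi> \<subseteq> module_homs A (canonical_module A) (regular_module A) \<and>
        s \<in> \<Phi> \<rightarrow> carrier (canonical_module A)}"

text \<open>For a positively graded algebra \<open>A = \<Oplus>\<^sub>d gr d\<close> with \<open>gr 0\<close> equal to the ground field,
  the graded maximal ideal is \<open>\<Oplus>\<^bsub>d>0\<^esub> gr d\<close>.\<close>

definition graded_max_ideal :: "('k::field, 'a) module \<Rightarrow> (nat \<Rightarrow> 'a set) \<Rightarrow> 'a set" where
  "graded_max_ideal A gr =
     {(\<Oplus>\<^bsub>A\<^esub>d\<in>D. a d) |D a. finite D \<and> 0 \<notin> D \<and> a \<in> Pi D gr}"

definition nearly_gorenstein :: "('k::field, 'a) module \<Rightarrow> (nat \<Rightarrow> 'a set) \<Rightarrow> bool" where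
  "nearly_gorenstein A gr \<longleftrightarrow> graded_max_ideal A gr \<subseteq> canonical_trace A"


section \<open>Basic well-formedness facts\<close>

lemma cring_poly_ring: "cring (poly_ring V :: 'k::field mpol ring)"
proof -
  let ?R = "poly_ring V :: 'k mpol ring"
  have add: "p + q \<in> carrier ?R" if "p \<in> carrier ?R" "q \<in> carrier ?R" for p q
    using that Poly_Mapping.keys_add[of p q] by (auto simp: poly_ring_def)
  have mult: "p * q \<in> carrier ?R" if pq: "p \<in> carrier ?R" "q \<in> carrier ?R" for p q
  proof -
    have "Poly_Mapping.keys t \<subseteq> V" if t: "t \<in> Poly_Mapping.keys (p * q)" for t
    proof -
      obtain a b where "t = a + b" "a \<in> Poly_Mapping.keys p" "b \<in> Poly_Mapping.keys q"
        using keys_mult[of p q] t by blast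
      moreover from this pq have "Poly_Mapping.keys a \<subseteq> V" "Poly_Mapping.keys b \<subseteq> V"
        by (simp_all add: poly_ring_def)
      ultimately show ?thesis
        using Poly_Mapping.keys_add[of a b] by blast
    qed
    then show ?thesis by (simp add: poly_ring_def)
  qed
  have uminus: "- p \<in> carrier ?R" if "p \<in> carrier ?R" for p
    using that by (simp add: poly_ring_def)
  have simps: "zero ?R = 0" "one ?R = 1" "Ring.add ?R = (+)" "mult ?R = (*)"
    by (simp_all add: poly_ring_def)
  have mem: "0 \<in> carrier ?R" "1 \<in> carrier ?R"
    by (simp_all add: poly_ring_def)
  have "abelian_group ?R"
  proof (rule abelian_groupI)
    fix p assume p: "p \<in> carrier ?R"
    show "\<exists>q\<in>carrier ?R. q \<oplus>\<^bsub>?R\<^esub> p = \<zero>\<^bsub>?R\<^esub>"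
      by (rule bexI[OF _ uminus[OF p]]) (simp add: simps)
  qed (simp_all add: simps add mem add.assoc add.commute)
  moreover have "Group.comm_monoid ?R"
    by (rule comm_monoidI) (simp_all add: simps mult mem mult.assoc mult.commute)
  ultimately show ?thesis
    by (rule cringI) (simp add: simps distrib_right)
qed

lemma Const_in_poly_ring: "Const c \<in> carrier (poly_ring V)"
  by (simp add: Const_def poly_ring_def)

lemma prod_Var_in_poly_ring:
  assumes "finite F" and "F \<subseteq> V"
  shows "(\<Prod>i\<in>F. Var i) \<in> carrier (poly_ring V :: 'k::field mpol ring)"
  using assms
proof (induction F rule: finite_induct)
  case empty
  then show ?case by (simp add: poly_ring_def)
next
  case (insert i F)
  interpret cring "poly_ring V :: 'k mpol ring" by (rule cring_poly_ring)
  have "Var i \<in> carrier (poly_ring V :: 'k mpol ring)"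
    using insert.prems by (simp add: Var_def poly_ring_def)
  with insert m_closed[of "Var i" "\<Prod>i\<in>F. Var i"] show ?case
    by (simp add: poly_ring_def)
qed

lemma Var_power_in_poly_ring:
  assumes "i \<in> V"
  shows "Var i ^ k \<in> carrier (poly_ring V :: 'k::field mpol ring)"
proof (induction k)
  case 0
  show ?case by (simp add: poly_ring_def)
next
  case (Suc k)
  interpret cring "poly_ring V :: 'k mpol ring" by (rule cring_poly_ring)
  have "Var i \<in> carrier (poly_ring V :: 'k mpol ring)"
    using assms by (simp add: Var_def poly_ring_def)
  with Suc m_closed[of "Var i" "Var i ^ k"] show ?case
    by (simp add: poly_ring_def)
qed

lemma ideal_defining_ideal:
  "ideal (defining_ideal m \<Delta> n) (poly_ring {1..m} :: 'k::field mpol ring)"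
proof -
  interpret cring "poly_ring {1..m} :: 'k mpol ring" by (rule cring_poly_ring)
  have "{\<Prod>i\<in>F. Var i |F. F \<subseteq> {1..m} \<and> F \<notin> \<Delta>}
      \<subseteq> carrier (poly_ring {1..m} :: 'k mpol ring)"
    using prod_Var_in_poly_ring finite_subset[of _ "{1..m}"] by blast
  moreover have "{Var i ^ n i |i. i \<in> {1..m}} \<subseteq> carrier (poly_ring {1..m} :: 'k mpol ring)"
    using Var_power_in_poly_ring by blast
  ultimately show ?thesis
    unfolding defining_ideal_def stanley_reisner_ideal_def pure_power_ideal_def
    by (intro add_ideals genideal_ideal)
qed

lemma A_alg_simps:
  "carrier (A_alg m \<Delta> n) = carrier (poly_ring {1..m} Quot defining_ideal m \<Delta> n)"
  "mult (A_alg m \<Delta> n) = mult (poly_ring {1..m} Quot defining_ideal m \<Delta> n)"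
  "one (A_alg m \<Delta> n) = one (poly_ring {1..m} Quot defining_ideal m \<Delta> n)"
  "zero (A_alg m \<Delta> n) = zero (poly_ring {1..m} Quot defining_ideal m \<Delta> n)"
  "add (A_alg m \<Delta> n) = add (poly_ring {1..m} Quot defining_ideal m \<Delta> n)"
  "smult (A_alg m \<Delta> n) = (\<lambda>c X. (defining_ideal m \<Delta> n +>\<^bsub>poly_ring {1..m}\<^esub> Const c)
      \<otimes>\<^bsub>poly_ring {1..m} Quot defining_ideal m \<Delta> n\<^esub> X)"
  by (simp_all add: A_alg_def Let_def ring.defs module.defs)

lemma cring_A_alg: "cring (A_alg m \<Delta> n :: ('k::field, 'k mpol set) module)"
proof -
  interpret ideal "defining_ideal m \<Delta> n" "poly_ring {1..m} :: 'k mpol ring"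
    by (rule ideal_defining_ideal)
  interpret Q: cring "poly_ring {1..m} Quot (defining_ideal m \<Delta> n :: 'k mpol set)"
    by (rule quotient_is_cring[OF cring_poly_ring])
  let ?A = "A_alg m \<Delta> n :: ('k, 'k mpol set) module"
  have "abelian_group ?A"
  proof (rule abelian_groupI)
    fix X assume "X \<in> carrier ?A"
    then show "\<exists>Y\<in>carrier ?A. Y \<oplus>\<^bsub>?A\<^esub> X = \<zero>\<^bsub>?A\<^esub>"
      unfolding A_alg_simps using Q.l_neg Q.a_inv_closed by blast
  qed (unfold A_alg_simps,
      (assumption | rule Q.a_closed Q.zero_closed Q.a_assoc Q.a_comm Q.l_zero)+)
  moreover have "Group.comm_monoid ?A"
    by (rule comm_monoidI; unfold A_alg_simps;
        (assumption | rule Q.m_closed Q.one_closed Q.m_assoc Q.m_comm Q.l_one)+)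
  ultimately show ?thesis
    by (rule cringI) (unfold A_alg_simps, rule Q.l_distr)
qed

end

theory Submission
  imports Defs
begin

text \<open>
  The nonzero monomials form a basis of \<open>A\<close>, and the canonical module is spanned by the dual basis,
  so \<open>A\<close> is nearly Gorenstein iff every \<open>x\<^sub>i\<close> lies in the trace.

  Suppose a homomorphism \<open>\<phi>\<close> sends the dual of a monomial \<open>x\<^sup>a\<close> to an element in which \<open>x\<^sub>i\<close> occurs.
  If \<open>x\<^sub>j\<close> does not divide \<open>x\<^sup>a\<close>, then \<open>x\<^sub>j\<close> kills the dual of \<open>x\<^sup>a\<close>, hence \<open>x\<^sub>i x\<^sub>j = 0\<close> in \<open>A\<close>. So the
  face \<open>supp a\<close> contains all neighbours of \<open>i\<close>, and if it omits \<open>i\<close> then \<open>n\<^sub>i = 2\<close>. Having such a face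
  for every vertex of a connected component forces it to be a simplex or the boundary of one.

  Conversely, let \<open>a\<close> be the exponent of the socle monomial on \<open>F = C\<close> in case (i), on \<open>F = C - {i}\<close> in
  case (ii), and \<open>\<delta> = a + e\<^sub>i\<close>. Then \<open>\<lambda> \<mapsto> \<Sum> \<lambda>(x\<^sup>u) x\<^sup>v\<close>, summed over all pairs of nonzero monomials with
  \<open>u + v = \<delta>\<close>, is \<open>A\<close>-linear and sends the dual of \<open>x\<^sup>a\<close> to \<open>x\<^sub>i\<close>. Linearity rests on \<open>x\<^sup>\<delta> = 0\<close> and
  \<open>\<delta>\<^sub>j \<ge> n\<^sub>j - 1\<close> on \<open>C\<close>: neither \<open>u\<close> nor \<open>v\<close> is ever zero, so variables outside \<open>C\<close> annihilate
  both monomials, and if \<open>j \<in> C\<close> and \<open>v\<^sub>j = 0\<close>, then \<open>u\<^sub>j\<close> is already maximal.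
\<close>

subsection \<open>Monomial basis\<close>

lemma poly_mapping_sum_single:
  "p = (\<Sum>t\<in>Poly_Mapping.keys p. Poly_Mapping.single t (Poly_Mapping.lookup p t))"
  by (rule poly_mapping_eqI)
    (simp add: lookup_sum lookup_single when_def in_keys_iff)

lemma single_mult_eq_sum:
  fixes t :: "'a::monoid_add" and p :: "'a \<Rightarrow>\<^sub>0 'b::semiring_0"
  shows "Poly_Mapping.single t c * p =
    (\<Sum>r\<in>Poly_Mapping.keys p. Poly_Mapping.single (t + r) (c * Poly_Mapping.lookup p r))"
  by (subst (1) poly_mapping_sum_single[of p]) (simp add: sum_distrib_left mult_single)

text \<open>Cancellation in the exponent monoid leaves \<open>s\<close> as the only exponent of
  \<open>p\<close> that contributes at \<open>t + s\<close>.\<close>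

lemma lookup_single_mult_add:
  fixes t s :: "'a::cancel_comm_monoid_add" and p :: "'a \<Rightarrow>\<^sub>0 'b::semiring_0"
  shows "Poly_Mapping.lookup (Poly_Mapping.single t c * p) (t + s) = c * Poly_Mapping.lookup p s"
  by (simp add: single_mult_eq_sum lookup_sum lookup_single when_def in_keys_iff)

lemma lookup_single_mult_eq_0:
  fixes t b :: "'a::monoid_add" and p :: "'a \<Rightarrow>\<^sub>0 'b::semiring_0"
  assumes "\<nexists>s. b = t + s"
  shows "Poly_Mapping.lookup (Poly_Mapping.single t c * p) b = 0"
  using assms
  by (auto simp: single_mult_eq_sum lookup_sum lookup_single when_def intro!: sum.neutral)

locale powers_complex =
  fixes m :: nat and \<Delta> :: "nat set set" and n :: "nat \<Rightarrow> nat"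
  assumes complex: "simplicial_complex m \<Delta>"
    and no_ghost: "i \<in> {1..m} \<Longrightarrow> {i} \<in> \<Delta>"
    and two_le: "i \<in> {1..m} \<Longrightarrow> 2 \<le> n i"
begin

declare One_nat_def [simp del]

section \<open>Faces and the exponents of nonzero monomials\<close>

lemma face_subset: "F \<in> \<Delta> \<Longrightarrow> F \<subseteq> {1..m}"
  and empty_face: "{} \<in> \<Delta>"
  and subset_face: "F \<in> \<Delta> \<Longrightarrow> F' \<subseteq> F \<Longrightarrow> F' \<in> \<Delta>"
  using complex by (auto simp: simplicial_complex_def)

lemma finite_face: "F \<in> \<Delta> \<Longrightarrow> finite F"
  using face_subset finite_subset by blast

text \<open>Exponents of the monomials that are nonzero in \<open>A\<close>.\<close>

definition exps :: "(nat \<Rightarrow>\<^sub>0 nat) set" where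
  "exps = {b. Poly_Mapping.keys b \<in> \<Delta> \<and> (\<forall>i\<in>{1..m}. Poly_Mapping.lookup b i < n i)}"

definition polys :: "'k::field mpol set" where
  "polys = {p. \<forall>t\<in>Poly_Mapping.keys p. Poly_Mapping.keys t \<subseteq> {1..m}}"

abbreviation alg :: "('k::field, 'k mpol set) module" where
  "alg \<equiv> A_alg m \<Delta> n"

abbreviation ideal_poly :: "'k::field mpol set" where
  "ideal_poly \<equiv> defining_ideal m \<Delta> n"

definition cls :: "'k::field mpol \<Rightarrow> 'k mpol set" where
  "cls p = ideal_poly +>\<^bsub>poly_ring {1..m}\<^esub> p"

text \<open>The choice of a representative is harmless for \<open>b\<close> in \<open>exps\<close>,
  where all representatives of a class agree (\<open>coef_cls\<close>). At other exponents the value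
  depends on the representative chosen.\<close>

definition coef :: "'k::field mpol set \<Rightarrow> (nat \<Rightarrow>\<^sub>0 nat) \<Rightarrow> 'k" where
  "coef X b = Poly_Mapping.lookup (SOME p. p \<in> X) b"

lemma carrier_poly_ring: "carrier (poly_ring {1..m}) = polys"
  by (simp add: poly_ring_def polys_def)

lemma poly_ring_ops:
  "mult (poly_ring V) = (*)" "one (poly_ring V) = 1" "zero (poly_ring V) = 0"
  "add (poly_ring V) = (+)"
  by (simp_all add: poly_ring_def)

lemma polys_closed:
  shows "p \<in> polys \<Longrightarrow> q \<in> polys \<Longrightarrow> p + q \<in> (polys :: 'k::field mpol set)"
    and "p \<in> polys \<Longrightarrow> q \<in> polys \<Longrightarrow> p * q \<in> (polys :: 'k mpol set)"
    and "0 \<in> (polys :: 'k mpol set)" and "1 \<in> (polys :: 'k mpol set)"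
    and "p \<in> polys \<Longrightarrow> q \<in> polys \<Longrightarrow> p - q \<in> (polys :: 'k mpol set)"
proof -
  interpret cring "poly_ring {1..m} :: 'k mpol ring" by (rule cring_poly_ring)
  note c = a_closed m_closed zero_closed one_closed
  show "p \<in> polys \<Longrightarrow> q \<in> polys \<Longrightarrow> p + q \<in> polys"
    "p \<in> polys \<Longrightarrow> q \<in> polys \<Longrightarrow> p * q \<in> polys" "0 \<in> (polys :: 'k mpol set)" "1 \<in> (polys :: 'k mpol set)"
    using c by (simp_all add: carrier_poly_ring poly_ring_ops)
  show "p \<in> polys \<Longrightarrow> q \<in> polys \<Longrightarrow> p - q \<in> polys"
    using keys_diff by (fastforce simp: polys_def)
qed

lemma single_in_polys: "Poly_Mapping.keys t \<subseteq> {1..m} \<Longrightarrow> Poly_Mapping.single t c \<in> polys"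
  by (simp add: polys_def)

lemma sum_in_polys: "(\<And>x. x \<in> T \<Longrightarrow> f x \<in> polys) \<Longrightarrow> sum f T \<in> polys"
  by (induction T rule: infinite_finite_induct) (auto intro: polys_closed)

lemma exps_keys: "b \<in> exps \<Longrightarrow> Poly_Mapping.keys b \<subseteq> {1..m}"
  using face_subset by (auto simp: exps_def)

lemma keys_add_nat: "Poly_Mapping.keys (s + t :: nat \<Rightarrow>\<^sub>0 nat) = Poly_Mapping.keys s \<union> Poly_Mapping.keys t"
  by (auto simp: in_keys_iff lookup_add)

text \<open>Faces are closed under subsets and the bounds on exponents pass to divisors. This
  order-ideal property of \<open>exps\<close> is what makes the polynomials without terms in
  \<open>exps\<close> an ideal.\<close>

lemma exps_down: "s + t \<in> exps \<Longrightarrow> s \<in> exps"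
  by (auto simp: exps_def keys_add_nat lookup_add intro: subset_face dest: add_lessD1)

lemma exps_down': "s + t \<in> exps \<Longrightarrow> t \<in> exps"
  using exps_down[of t s] by (simp add: add.commute)

lemma zero_exps: "0 \<in> exps"
  by (auto simp: exps_def empty_face dest: two_le)

lemma Var_exps: "i \<in> {1..m} \<Longrightarrow> Poly_Mapping.single i 1 \<in> exps"
  by (auto simp: exps_def lookup_single when_def no_ghost dest: two_le)

lemma Var_in_polys: "i \<in> {1..m} \<Longrightarrow> Var i \<in> (polys :: 'k::field mpol set)"
  by (auto simp: Var_def intro: single_in_polys)

lemma finite_exps: "finite exps"
proof -
  \<comment> \<open>One bound valid for all exponents embeds \<open>exps\<close> into the functions
    from a finite set to a finite set, extended by 0.\<close>
  let ?N = "\<Sum>i\<in>{1..m}. n i"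
  have "Poly_Mapping.lookup ` exps
      \<subseteq> {f. f ` {1..m} \<subseteq> {..?N} \<and> (\<forall>i. i \<notin> {1..m} \<longrightarrow> f i = 0)}" (is "_ \<subseteq> ?S")
  proof safe
    fix b i assume b: "b \<in> exps"
    { assume i: "i \<in> {1..m}"
      have "Poly_Mapping.lookup b i \<le> n i" using b i by (auto simp: exps_def intro: less_imp_le)
      also have "\<dots> \<le> ?N" using i by (intro member_le_sum) auto
      finally show "Poly_Mapping.lookup b i \<le> ?N" . }
    assume "i \<notin> {1..m}"
    then show "Poly_Mapping.lookup b i = 0"
      using exps_keys[OF b] by (auto simp: in_keys_iff)
  qed
  moreover have "finite ?S"
    by (rule finite_subset[OF _ finite_set_of_finite_funs[of "{1..m}" "{..?N}" 0]])
      (auto simp: image_subset_iff Ball_def)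
  ultimately have "finite (Poly_Mapping.lookup ` exps)"
    using finite_subset by blast
  moreover have "inj_on Poly_Mapping.lookup exps"
    by (auto intro: inj_onI poly_mapping_eqI)
  ultimately show ?thesis
    using finite_imageD by blast
qed

section \<open>The defining ideal in terms of coefficients\<close>

lemma prod_Var: "finite F \<Longrightarrow>
  (\<Prod>i\<in>F. Var i ^ f i) = (Poly_Mapping.single (\<Sum>i\<in>F. Poly_Mapping.single i (f i)) 1 :: 'k::field mpol)"
proof (induction F rule: finite_induct)
  case empty
  then show ?case by simp
next
  case (insert i F)
  have "(Var i :: 'k mpol) ^ k = Poly_Mapping.single (Poly_Mapping.single i k) 1" for k
    by (induction k) (simp_all add: Var_def mult_single flip: single_add Suc_eq_plus1_left)
  with insert show ?case by (simp add: mult_single)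
qed

lemma Var_power: "(Var i ^ k :: 'k::field mpol) = Poly_Mapping.single (Poly_Mapping.single i k) 1"
  using prod_Var[of "{i}" "\<lambda>_. k"] by simp

text \<open>Turns componentwise inequality of exponents into divisibility of monomials; truncated
  subtraction supplies the quotient.\<close>

lemma sum_single_add_diff:
  assumes "finite F" "\<And>i. i \<in> F \<Longrightarrow> f i \<le> Poly_Mapping.lookup t i"
  shows "\<exists>s. t = (\<Sum>i\<in>F. Poly_Mapping.single i (f i)) + (s :: nat \<Rightarrow>\<^sub>0 nat)"
  by (rule exI[of _ "t - (\<Sum>i\<in>F. Poly_Mapping.single i (f i))"], rule poly_mapping_eqI)
    (use assms in \<open>auto simp: lookup_add lookup_minus lookup_sum lookup_single when_def\<close>)

text \<open>A coefficient of \<open>q * p\<close> at \<open>b\<close> in \<open>exps\<close> is a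
  combination of coefficients of \<open>p\<close> at divisors of \<open>b\<close>, and these
  divisors lie in \<open>exps\<close> again.\<close>

lemma zero_coeffs_ideal:
  "ideal {p \<in> polys. \<forall>b\<in>exps. Poly_Mapping.lookup p b = 0} (poly_ring {1..m} :: 'k::field mpol ring)"
    (is "ideal ?J ?R")
proof -
  interpret cring ?R by (rule cring_poly_ring)
  have mult: "q * p \<in> ?J" if p: "p \<in> ?J" and q: "q \<in> polys" for p q
  proof -
    have "Poly_Mapping.lookup (q * p) b = 0" if b: "b \<in> exps" for b
    proof -
      have "Poly_Mapping.lookup (Poly_Mapping.single t c * p) b = 0" for t c
      proof (cases "\<exists>s. b = t + s")
        case True
        then show ?thesis
          using p b exps_down'[of t] by (auto simp: lookup_single_mult_add)
      qed (rule lookup_single_mult_eq_0)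
      then show ?thesis
        by (subst poly_mapping_sum_single[of q]) (simp add: sum_distrib_right lookup_sum)
    qed
    with p q show ?thesis by (auto intro: polys_closed)
  qed
  show ?thesis
  proof (rule idealI)
    show "subgroup ?J (add_monoid ?R)"
    proof (rule add.subgroupI)
      show "?J \<noteq> {}" using polys_closed(3) by (auto intro!: exI[of _ 0])
    next
      fix p assume p: "p \<in> ?J"
      then have "\<ominus>\<^bsub>?R\<^esub> p = - p"
        by (intro minus_equality)
          (auto simp: carrier_poly_ring poly_ring_ops polys_def)
      with p show "\<ominus>\<^bsub>?R\<^esub> p \<in> ?J" by (simp add: polys_def)
    qed (auto simp: carrier_poly_ring poly_ring_ops lookup_add intro: polys_closed)
  qed (use mult ring_axioms in \<open>auto simp: carrier_poly_ring poly_ring_ops mult.commute\<close>)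
qed

text \<open>The generators have no term in \<open>exps\<close>, which gives one inclusion.
  Conversely, each monomial outside \<open>exps\<close> is a multiple of a generator. Hence the
  classes of the monomials in \<open>exps\<close> form a basis of the algebra.\<close>

lemma ideal_poly_eq:
  "(ideal_poly :: 'k::field mpol set) = {p \<in> polys. \<forall>b\<in>exps. Poly_Mapping.lookup p b = 0}"
    (is "_ = ?J")
proof
  interpret cring "poly_ring {1..m} :: 'k mpol ring" by (rule cring_poly_ring)
  interpret J: ideal ?J "poly_ring {1..m} :: 'k mpol ring" by (rule zero_coeffs_ideal)
  interpret I: ideal ideal_poly "poly_ring {1..m} :: 'k mpol ring" by (rule ideal_defining_ideal)
  have gens: "{\<Prod>i\<in>F. Var i |F. F \<subseteq> {1..m} \<and> F \<notin> \<Delta>} \<subseteq> ?J"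
  proof safe
    fix F b assume F: "F \<subseteq> {1..m}" "F \<notin> \<Delta>"
    then have fin: "finite F" using finite_subset by blast
    show "(\<Prod>i\<in>F. Var i) \<in> polys"
      using prod_Var_in_poly_ring[OF fin F(1)] by (simp add: carrier_poly_ring)
    assume b: "b \<in> exps"
    have "F \<subseteq> Poly_Mapping.keys (\<Sum>i\<in>F. Poly_Mapping.single i (1::nat))"
      using fin by (auto simp: in_keys_iff lookup_sum lookup_single when_def)
    then have "b \<noteq> (\<Sum>i\<in>F. Poly_Mapping.single i 1)"
      using F b subset_face by (auto simp: exps_def)
    then show "Poly_Mapping.lookup (\<Prod>i\<in>F. Var i :: 'k mpol) b = 0"
      using prod_Var[where 'k='k, OF fin, of "\<lambda>_. 1"] by (simp add: lookup_single when_def)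
  qed
  have gens': "{Var i ^ n i |i. i \<in> {1..m}} \<subseteq> ?J"
  proof safe
    fix i b assume i: "i \<in> {1..m}"
    show "Var i ^ n i \<in> polys"
      using Var_power_in_poly_ring[OF i] by (simp add: carrier_poly_ring)
    assume "b \<in> exps"
    with i have "Poly_Mapping.lookup b i < n i"
      by (simp add: exps_def)
    then have "b \<noteq> Poly_Mapping.single i (n i)"
      by auto
    then show "Poly_Mapping.lookup (Var i ^ n i :: 'k mpol) b = 0"
      by (simp add: Var_power lookup_single when_def)
  qed
  show "ideal_poly \<subseteq> ?J"
  proof
    fix p :: "'k mpol" assume "p \<in> ideal_poly"
    then obtain q r where qr: "q \<in> stanley_reisner_ideal m \<Delta>" "r \<in> pure_power_ideal m n" "p = q + r"
      unfolding defining_ideal_def set_add_def' poly_ring_ops by blast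
    have "q \<in> ?J"
      using genideal_minimal[OF zero_coeffs_ideal gens] qr(1)
      unfolding stanley_reisner_ideal_def by blast
    moreover have "r \<in> ?J"
      using genideal_minimal[OF zero_coeffs_ideal gens'] qr(2)
      unfolding pure_power_ideal_def by blast
    ultimately show "p \<in> ?J"
      using J.a_closed unfolding poly_ring_ops qr(3) by blast
  qed
  have SR: "(stanley_reisner_ideal m \<Delta> :: 'k mpol set) \<subseteq> ideal_poly"
    and PP: "(pure_power_ideal m n :: 'k mpol set) \<subseteq> ideal_poly"
  proof -
    have 1: "ideal (stanley_reisner_ideal m \<Delta>) (poly_ring {1..m} :: 'k mpol ring)"
      unfolding stanley_reisner_ideal_def
      using gens carrier_poly_ring by (intro genideal_ideal) blast
    have 2: "ideal (pure_power_ideal m n) (poly_ring {1..m} :: 'k mpol ring)"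
      unfolding pure_power_ideal_def
      using gens' carrier_poly_ring by (intro genideal_ideal) blast
    interpret I1: ideal "stanley_reisner_ideal m \<Delta>" "poly_ring {1..m} :: 'k mpol ring" by (rule 1)
    interpret I2: ideal "pure_power_ideal m n" "poly_ring {1..m} :: 'k mpol ring" by (rule 2)
    show "(stanley_reisner_ideal m \<Delta> :: 'k mpol set) \<subseteq> ideal_poly"
    proof
      fix p :: "'k mpol" assume "p \<in> stanley_reisner_ideal m \<Delta>"
      then have "p + 0 \<in> ideal_poly"
        using I2.zero_closed unfolding defining_ideal_def set_add_def' poly_ring_ops by blast
      then show "p \<in> ideal_poly" by simp
    qed
    show "(pure_power_ideal m n :: 'k mpol set) \<subseteq> ideal_poly"
    proof
      fix p :: "'k mpol" assume "p \<in> pure_power_ideal m n"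
      then have "0 + p \<in> ideal_poly"
        using I1.zero_closed unfolding defining_ideal_def set_add_def' poly_ring_ops by blast
      then show "p \<in> ideal_poly" by simp
    qed
  qed
  have gens_in: "(\<Prod>i\<in>F. Var i :: 'k mpol) \<in> ideal_poly" if "F \<subseteq> {1..m}" "F \<notin> \<Delta>" for F
  proof -
    have "{\<Prod>i\<in>F. Var i |F. F \<subseteq> {1..m} \<and> F \<notin> \<Delta>} \<subseteq> (stanley_reisner_ideal m \<Delta> :: 'k mpol set)"
      unfolding stanley_reisner_ideal_def using gens carrier_poly_ring by (intro genideal_self) blast
    with SR that show ?thesis by blast
  qed
  have gens'_in: "(Var i ^ n i :: 'k mpol) \<in> ideal_poly" if "i \<in> {1..m}" for i
  proof -
    have "{Var i ^ n i |i. i \<in> {1..m}} \<subseteq> (pure_power_ideal m n :: 'k mpol set)"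
      unfolding pure_power_ideal_def using gens' carrier_poly_ring by (intro genideal_self) blast
    with PP that show ?thesis by blast
  qed
  have monom: "Poly_Mapping.single t c \<in> (ideal_poly :: 'k mpol set)"
    if t: "Poly_Mapping.keys t \<subseteq> {1..m}" "t \<notin> exps" for t c
  proof -
    \<comment> \<open>Either the support of \<open>t\<close> is a non-face, and its squarefree
      generator divides the monomial, or some exponent reaches \<open>n i\<close>, and the pure
      power divides it.\<close>
    have *: "\<exists>r s. Poly_Mapping.single r 1 \<in> (ideal_poly :: 'k mpol set) \<and> t = r + s"
    proof (cases "Poly_Mapping.keys t \<in> \<Delta>")
      case False
      have "\<exists>s. t = (\<Sum>i\<in>Poly_Mapping.keys t. Poly_Mapping.single i 1) + s"
        by (rule sum_single_add_diff) (simp_all add: in_keys_iff Suc_le_eq)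
      then show ?thesis
        using gens_in[OF t(1) False] prod_Var[of "Poly_Mapping.keys t" "\<lambda>_. 1"]
        by (metis (mono_tags, lifting) finite_keys power_one_right prod.cong)
    next
      case True
      with t obtain i where i: "i \<in> {1..m}" "n i \<le> Poly_Mapping.lookup t i"
        by (auto simp: exps_def not_less)
      then have "\<exists>s. t = (\<Sum>i\<in>{i}. Poly_Mapping.single i (n i)) + s"
        by (intro sum_single_add_diff) auto
      then show ?thesis
        using gens'_in[OF i(1)] by (auto simp: Var_power)
    qed
    then obtain r s where rs: "Poly_Mapping.single r 1 \<in> (ideal_poly :: 'k mpol set)" "t = r + s"
      by blast
    then have "Poly_Mapping.keys s \<subseteq> {1..m}" using t by (simp add: keys_add_nat)
    then have "Poly_Mapping.single s c \<in> carrier (poly_ring {1..m} :: 'k mpol ring)"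
      by (simp add: carrier_poly_ring single_in_polys)
    from I.I_r_closed[OF rs(1) this] show ?thesis
      by (simp add: poly_ring_ops mult_single rs(2))
  qed
  have sums: "sum f T \<in> ideal_poly" if "\<And>t. t \<in> T \<Longrightarrow> f t \<in> ideal_poly"
    for f :: "(nat \<Rightarrow>\<^sub>0 nat) \<Rightarrow> 'k mpol" and T
    using that I.zero_closed I.a_closed
    by (induction T rule: infinite_finite_induct) (auto simp: poly_ring_ops)
  show "?J \<subseteq> ideal_poly"
  proof
    fix p :: "'k mpol" assume p: "p \<in> ?J"
    show "p \<in> ideal_poly"
      by (subst poly_mapping_sum_single[of p], rule sums, rule monom)
        (use p in \<open>auto simp: polys_def in_keys_iff\<close>)
  qed
qed

section \<open>Computing in the quotient algebra\<close>

lemma cls_eq: "cls p = {h + p |h. h \<in> ideal_poly}"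
  by (auto simp: cls_def a_r_coset_def' poly_ring_ops)

lemma cls_eq_iff:
  assumes "p \<in> polys" "q \<in> polys"
  shows "cls p = cls q \<longleftrightarrow> (\<forall>b\<in>exps. Poly_Mapping.lookup p b = Poly_Mapping.lookup q b)"
proof
  assume "cls p = cls q"
  moreover have "p \<in> cls p" by (auto simp: cls_eq ideal_poly_eq polys_closed)
  ultimately show "\<forall>b\<in>exps. Poly_Mapping.lookup p b = Poly_Mapping.lookup q b"
    by (auto simp: cls_eq ideal_poly_eq lookup_add)
next
  interpret ideal ideal_poly "poly_ring {1..m} :: 'a mpol ring" by (rule ideal_defining_ideal)
  assume "\<forall>b\<in>exps. Poly_Mapping.lookup p b = Poly_Mapping.lookup q b"
  then have "p - q \<in> ideal_poly"
    using assms by (simp add: ideal_poly_eq lookup_minus polys_closed)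
  moreover have "p = (p - q) + q" by simp
  ultimately have "p \<in> cls q" unfolding cls_eq by blast
  then show "cls p = cls q"
    using a_repr_independence'[of p q] assms by (simp add: cls_def carrier_poly_ring)
qed

lemma coef_cls:
  assumes "p \<in> polys" "b \<in> exps"
  shows "coef (cls p) b = Poly_Mapping.lookup p b"
proof -
  have "p \<in> cls p" by (auto simp: cls_eq ideal_poly_eq polys_closed)
  then have "(SOME q. q \<in> cls p) \<in> cls p" by (rule someI)
  then show ?thesis
    using assms by (auto simp: coef_def cls_eq ideal_poly_eq lookup_add)
qed

lemma alg_ops:
  shows "carrier alg = cls ` (polys :: 'k::field mpol set)"
    and "\<zero>\<^bsub>alg\<^esub> = cls (0 :: 'k mpol)"
    and "p \<in> polys \<Longrightarrow> q \<in> polys \<Longrightarrow> cls p \<oplus>\<^bsub>alg\<^esub> cls q = cls (p + q :: 'k mpol)"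
    and "p \<in> polys \<Longrightarrow> q \<in> polys \<Longrightarrow> cls p \<otimes>\<^bsub>alg\<^esub> cls q = cls (p * q :: 'k mpol)"
    and "p \<in> polys \<Longrightarrow> c \<odot>\<^bsub>alg\<^esub> cls p = cls (Const c * p :: 'k mpol)"
proof -
  interpret ideal ideal_poly "poly_ring {1..m} :: 'k mpol ring" by (rule ideal_defining_ideal)
  show "carrier alg = cls ` (polys :: 'k mpol set)"
    by (auto simp: A_alg_simps FactRing_def A_RCOSETS_def' cls_def carrier_poly_ring)
  show "\<zero>\<^bsub>alg\<^esub> = cls (0 :: 'k mpol)"
    unfolding A_alg_simps by (auto simp: FactRing_def cls_eq)
  show "p \<in> polys \<Longrightarrow> q \<in> polys \<Longrightarrow> cls p \<oplus>\<^bsub>alg\<^esub> cls q = cls (p + q :: 'k mpol)"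
    using a_rcos_sum[of p q]
    by (simp add: A_alg_simps FactRing_def cls_def carrier_poly_ring poly_ring_ops)
  show m: "p \<in> polys \<Longrightarrow> q \<in> polys \<Longrightarrow> cls p \<otimes>\<^bsub>alg\<^esub> cls q = cls (p * q :: 'k mpol)" for p q
    using rcoset_mult_add[of p q]
    by (simp add: A_alg_simps FactRing_def cls_def carrier_poly_ring poly_ring_ops)
  have "Const c \<in> (polys :: 'k mpol set)"
    using Const_in_poly_ring carrier_poly_ring by blast
  then show "p \<in> polys \<Longrightarrow> c \<odot>\<^bsub>alg\<^esub> cls p = cls (Const c * p :: 'k mpol)"
    using m[of "Const c" p] by (simp add: A_alg_simps cls_def)
qed

subsection \<open>The canonical module and its trace\<close>

abbreviation omega :: "('k::field mpol set, 'k mpol set \<Rightarrow> 'k) module" where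
  "omega \<equiv> canonical_module alg"

abbreviation homs :: "(('k::field mpol set \<Rightarrow> 'k) \<Rightarrow> 'k mpol set) set" where
  "homs \<equiv> module_homs alg omega (regular_module alg)"

definition mon :: "(nat \<Rightarrow>\<^sub>0 nat) \<Rightarrow> 'k::field \<Rightarrow> 'k mpol set" where
  "mon t c = cls (Poly_Mapping.single t c)"

text \<open>For \<open>a\<close> in \<open>exps\<close> this is \<open>c\<close> times the element
  dual to the monomial with exponent \<open>a\<close> in the basis of nonzero monomials.\<close>

definition dual :: "(nat \<Rightarrow>\<^sub>0 nat) \<Rightarrow> 'k::field \<Rightarrow> 'k mpol set \<Rightarrow> 'k" where
  "dual a c = (\<lambda>X\<in>carrier alg. c * coef X a)"

lemma mon_carrier: "Poly_Mapping.keys t \<subseteq> {1..m} \<Longrightarrow> mon t c \<in> carrier alg"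
  by (simp add: mon_def alg_ops single_in_polys)

lemma mon_exps_carrier: "t \<in> exps \<Longrightarrow> mon t c \<in> carrier alg"
  by (intro mon_carrier exps_keys)

lemma alg_eqI:
  assumes "X \<in> carrier alg" "Y \<in> carrier alg" "\<And>b. b \<in> exps \<Longrightarrow> coef X b = coef Y b"
  shows "X = (Y :: 'k::field mpol set)"
proof -
  obtain p q where "p \<in> polys" "X = cls p" "q \<in> polys" "Y = cls q"
    using assms by (auto simp: alg_ops)
  with assms(3) show ?thesis by (simp add: cls_eq_iff coef_cls)
qed

lemma coef_add:
  "X \<in> carrier alg \<Longrightarrow> Y \<in> carrier alg \<Longrightarrow> b \<in> exps \<Longrightarrow>
    coef (X \<oplus>\<^bsub>alg\<^esub> Y) b = coef X b + coef Y b"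
  by (auto simp: alg_ops coef_cls lookup_add polys_closed)

lemma coef_zero: "b \<in> exps \<Longrightarrow> coef \<zero>\<^bsub>alg\<^esub> b = 0"
  by (simp add: alg_ops coef_cls polys_closed)

lemma coef_mon: "Poly_Mapping.keys t \<subseteq> {1..m} \<Longrightarrow> b \<in> exps \<Longrightarrow> coef (mon t c) b = (if b = t then c else 0)"
  by (simp add: mon_def coef_cls single_in_polys lookup_single)

lemma coef_mon_mult:
  assumes "X \<in> carrier alg" "Poly_Mapping.keys t \<subseteq> {1..m}" "t + s \<in> exps"
  shows "coef (mon t c \<otimes>\<^bsub>alg\<^esub> X) (t + s) = c * coef X s"
  using assms exps_down'[OF assms(3)]
  by (auto simp: mon_def alg_ops single_in_polys coef_cls polys_closed lookup_single_mult_add)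

lemma coef_mon_mult_eq_0:
  assumes "X \<in> carrier alg" "Poly_Mapping.keys t \<subseteq> {1..m}" "b \<in> exps" "\<nexists>s. b = t + s"
  shows "coef (mon t c \<otimes>\<^bsub>alg\<^esub> X) b = 0"
  using assms
  by (auto simp: mon_def alg_ops single_in_polys coef_cls polys_closed lookup_single_mult_eq_0)

lemma mon_mult:
  "Poly_Mapping.keys s \<subseteq> {1..m} \<Longrightarrow> Poly_Mapping.keys t \<subseteq> {1..m} \<Longrightarrow>
    mon s c \<otimes>\<^bsub>alg\<^esub> mon t d = mon (s + t) (c * d)"
  by (simp add: mon_def alg_ops single_in_polys mult_single)

lemma mon_eq_zero: "Poly_Mapping.keys t \<subseteq> {1..m} \<Longrightarrow> t \<notin> exps \<Longrightarrow> mon t c = \<zero>\<^bsub>alg\<^esub>"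
  by (auto simp: mon_def alg_ops cls_eq_iff single_in_polys polys_closed lookup_single when_def)

lemma Const_in_polys: "Const c \<in> polys"
  using Const_in_poly_ring carrier_poly_ring by blast

lemma smult_mon: "Poly_Mapping.keys t \<subseteq> {1..m} \<Longrightarrow> c \<odot>\<^bsub>alg\<^esub> mon t d = mon t (c * d)"
  by (simp add: mon_def alg_ops single_in_polys Const_def mult_single)

lemma coef_smult: "X \<in> carrier alg \<Longrightarrow> b \<in> exps \<Longrightarrow> coef (c \<odot>\<^bsub>alg\<^esub> X) b = c * coef X b"
  using lookup_single_mult_add[of 0 c _ b]
  by (auto simp: alg_ops coef_cls Const_in_polys polys_closed) (simp add: Const_def)

text \<open>The terms of the monomial expansion of \<open>X\<close> are added one at a time. The
  step remembers that \<open>t\<close> occurs in \<open>X\<close>; in the reduction to the variables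
  this excludes the constant term.\<close>

lemma alg_induct [consumes 1, case_names zero add]:
  assumes X: "X \<in> carrier alg"
    and zero: "P \<zero>\<^bsub>alg\<^esub>"
    and add: "\<And>Y t. \<lbrakk>Y \<in> carrier alg; P Y; t \<in> exps; coef X t \<noteq> 0\<rbrakk> \<Longrightarrow>
      P (Y \<oplus>\<^bsub>alg\<^esub> mon t (coef X t))"
  shows "P (X :: 'k::field mpol set)"
proof -
  define f where "f T = (\<Sum>t\<in>T. Poly_Mapping.single t (coef X t))" for T
  have f_polys: "f T \<in> polys" if "T \<subseteq> exps" for T
    unfolding f_def using that exps_keys by (intro sum_in_polys single_in_polys) blast
  let ?T = "{t \<in> exps. coef X t \<noteq> 0}"
  have "finite T \<Longrightarrow> T \<subseteq> ?T \<Longrightarrow> P (cls (f T))" for T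
  proof (induction T rule: finite_induct)
    case empty
    then show ?case using zero by (simp add: f_def alg_ops)
  next
    case (insert t T)
    then have fT: "f T \<in> polys" "Poly_Mapping.single t (coef X t) \<in> polys"
      using exps_keys by (auto intro!: f_polys single_in_polys)
    have "P (cls (f T) \<oplus>\<^bsub>alg\<^esub> mon t (coef X t))"
      using insert fT by (intro add) (auto simp: alg_ops)
    moreover have "f (insert t T) = f T + Poly_Mapping.single t (coef X t)"
      using insert by (simp add: f_def add.commute)
    ultimately show ?case
      using fT by (simp add: mon_def alg_ops)
  qed
  then have "P (cls (f ?T))" using finite_exps by simp
  moreover have "cls (f ?T) = X"
  proof (rule alg_eqI)
    show "coef (cls (f ?T)) b = coef X b" if "b \<in> exps" for b
      using that finite_exps
      by (subst coef_cls) (auto intro: f_polys, auto simp: f_def lookup_sum lookup_single when_def)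
  qed (use X in \<open>auto simp: alg_ops intro: f_polys\<close>)
  ultimately show ?thesis by simp
qed

section \<open>Linear forms, the dual basis and homomorphisms\<close>

lemma omega_ops:
  "s \<oplus>\<^bsub>omega\<^esub> s' = (\<lambda>X\<in>carrier alg. s X + s' X)"
  "a \<odot>\<^bsub>omega\<^esub> s = (\<lambda>X\<in>carrier alg. s (a \<otimes>\<^bsub>alg\<^esub> X))"
  "\<zero>\<^bsub>omega\<^esub> = (\<lambda>X\<in>carrier alg. 0)"
  by (simp_all add: canonical_module_def)

lemma omegaD:
  assumes "s \<in> carrier omega"
  shows "s \<in> extensional (carrier alg)"
    and "X \<in> carrier alg \<Longrightarrow> Y \<in> carrier alg \<Longrightarrow> s (X \<oplus>\<^bsub>alg\<^esub> Y) = s X + s Y"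
    and "X \<in> carrier alg \<Longrightarrow> s (c \<odot>\<^bsub>alg\<^esub> X) = c * s X"
  using assms by (auto simp: canonical_module_def PiE_def)

lemma omegaI:
  assumes "s \<in> extensional (carrier alg)"
    and "\<And>X Y. X \<in> carrier alg \<Longrightarrow> Y \<in> carrier alg \<Longrightarrow> s (X \<oplus>\<^bsub>alg\<^esub> Y) = s X + s Y"
    and "\<And>c X. X \<in> carrier alg \<Longrightarrow> s (c \<odot>\<^bsub>alg\<^esub> X) = c * s X"
  shows "s \<in> carrier omega"
  using assms by (auto simp: canonical_module_def PiE_def)

lemma smult_carrier: "X \<in> carrier alg \<Longrightarrow> c \<odot>\<^bsub>alg\<^esub> X \<in> carrier alg"
  by (auto simp: alg_ops Const_in_polys polys_closed)

lemma omega_zero: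
  assumes "s \<in> carrier omega" shows "s \<zero>\<^bsub>alg\<^esub> = 0"
proof -
  interpret A: cring alg by (rule cring_A_alg)
  show ?thesis
    using omegaD(2)[OF assms A.zero_closed A.zero_closed] A.l_zero[OF A.zero_closed]
    by (metis add_cancel_right_right)
qed

lemma omega_mon:
  assumes "s \<in> carrier omega" "Poly_Mapping.keys t \<subseteq> {1..m}"
  shows "s (mon t c) = c * s (mon t 1)"
  using omegaD(3)[OF assms(1) mon_carrier[OF assms(2)], of c 1] smult_mon[OF assms(2), of c 1]
  by simp

lemma omega_add_closed:
  assumes "s \<in> carrier omega" "s' \<in> carrier omega"
  shows "s \<oplus>\<^bsub>omega\<^esub> s' \<in> carrier omega"
proof -
  interpret A: cring alg by (rule cring_A_alg)
  show ?thesis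
    by (rule omegaI) (auto simp: omega_ops omegaD(2,3)[OF assms(1)] omegaD(2,3)[OF assms(2)]
        smult_carrier algebra_simps)
qed

lemma smult_mult_right:
  "X \<in> carrier alg \<Longrightarrow> Y \<in> carrier alg \<Longrightarrow>
    X \<otimes>\<^bsub>alg\<^esub> (c \<odot>\<^bsub>alg\<^esub> Y) = c \<odot>\<^bsub>alg\<^esub> (X \<otimes>\<^bsub>alg\<^esub> Y)"
  by (auto simp: alg_ops Const_in_polys polys_closed mult_ac)

lemma omega_smult_closed:
  assumes "s \<in> carrier omega" "a \<in> carrier alg"
  shows "a \<odot>\<^bsub>omega\<^esub> s \<in> carrier omega"
proof -
  interpret A: cring alg by (rule cring_A_alg)
  show ?thesis
    using assms(2)
    by (intro omegaI) (auto simp: omega_ops omegaD(2,3)[OF assms(1)]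
        smult_carrier smult_mult_right A.r_distr)
qed

lemma omega_zero_closed: "\<zero>\<^bsub>omega\<^esub> \<in> carrier omega"
proof -
  interpret A: cring alg by (rule cring_A_alg)
  show ?thesis
    by (intro omegaI) (auto simp: omega_ops smult_carrier)
qed

lemma dual_closed:
  assumes "a \<in> exps" shows "dual a c \<in> carrier omega"
proof -
  interpret A: cring alg by (rule cring_A_alg)
  show ?thesis
    using assms by (intro omegaI)
      (auto simp: dual_def coef_add coef_smult smult_carrier algebra_simps)
qed

lemma homsD:
  assumes "\<phi> \<in> homs"
  shows "s \<in> carrier omega \<Longrightarrow> \<phi> s \<in> carrier alg"
    and "s \<in> carrier omega \<Longrightarrow> s' \<in> carrier omega \<Longrightarrow> \<phi> (s \<oplus>\<^bsub>omega\<^esub> s') = \<phi> s \<oplus>\<^bsub>alg\<^esub> \<phi> s'"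
    and "a \<in> carrier alg \<Longrightarrow> s \<in> carrier omega \<Longrightarrow> \<phi> (a \<odot>\<^bsub>omega\<^esub> s) = a \<otimes>\<^bsub>alg\<^esub> \<phi> s"
  using assms by (auto simp: module_homs_def regular_module_def)

text \<open>The zero form is zero times itself, so linearity over \<open>alg\<close>
  applies.\<close>

lemma hom_zero:
  assumes "\<phi> \<in> homs" shows "\<phi> \<zero>\<^bsub>omega\<^esub> = \<zero>\<^bsub>alg\<^esub>"
proof -
  interpret A: cring alg by (rule cring_A_alg)
  have "\<zero>\<^bsub>alg\<^esub> \<odot>\<^bsub>omega\<^esub> \<zero>\<^bsub>omega\<^esub> = \<zero>\<^bsub>omega\<^esub>"
    by (auto simp: omega_ops)
  then show ?thesis
    using homsD(3)[OF assms A.zero_closed omega_zero_closed] homsD(1)[OF assms omega_zero_closed]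
    by (metis A.l_null)
qed

text \<open>Both sides are additive in \<open>X\<close> and agree on monomials. This is the
  expansion of \<open>s\<close> in the dual basis.\<close>

lemma omega_expand:
  assumes "s \<in> carrier omega" "X \<in> carrier alg"
  shows "s X = (\<Sum>a\<in>exps. s (mon a 1) * coef X a)"
  using assms(2)
proof (induction X rule: alg_induct)
  case zero
  then show ?case using assms(1) by (simp add: omega_zero coef_zero)
next
  case (add Y t)
  have "(\<Sum>a\<in>exps. s (mon a 1) * coef (mon t (coef X t)) a) = coef X t * s (mon t 1)"
    using finite_exps add exps_keys by (simp add: coef_mon if_distrib cong: if_cong)
  then have "s Y + s (mon t (coef X t)) =
      (\<Sum>a\<in>exps. s (mon a 1) * coef Y a) + (\<Sum>a\<in>exps. s (mon a 1) * coef (mon t (coef X t)) a)"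
    using add.IH omega_mon[OF assms(1) exps_keys[OF add.hyps(2)], of "coef X t"] by simp
  then show ?case
    using add.hyps
    by (simp add: omegaD(2)[OF assms(1)] mon_exps_carrier coef_add distrib_left sum.distrib)
qed

text \<open>Since \<open>s\<close> is a sum of dual forms, a coefficient that vanishes on the images
  of all of them also vanishes on the image of \<open>s\<close>. It therefore suffices to test
  homomorphisms on dual forms.\<close>

lemma hom_dual_nonzero:
  assumes \<phi>: "\<phi> \<in> homs" and s: "s \<in> carrier omega" and b: "b \<in> exps"
    and nz: "coef (\<phi> s) b \<noteq> 0"
  shows "\<exists>a\<in>exps. \<exists>c. coef (\<phi> (dual a c)) b \<noteq> 0"
proof (rule ccontr)
  assume H: "\<not> ?thesis"
  \<comment> \<open>Partial sums of the expansion of \<open>s\<close> in the dual basis;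
    \<open>f exps\<close> is \<open>s\<close> itself.\<close>
  define f where "f T = (\<lambda>X\<in>carrier alg. \<Sum>a\<in>T. s (mon a 1) * coef X a)" for T
  have "finite T \<Longrightarrow> T \<subseteq> exps \<Longrightarrow> f T \<in> carrier omega \<and> coef (\<phi> (f T)) b = 0" for T
  proof (induction T rule: finite_induct)
    case empty
    have "f {} = \<zero>\<^bsub>omega\<^esub>" by (simp add: f_def omega_ops)
    then show ?case using b \<phi> by (simp add: omega_zero_closed hom_zero coef_zero)
  next
    case (insert a T)
    then have a: "a \<in> exps" by simp
    have "f (insert a T) = dual a (s (mon a 1)) \<oplus>\<^bsub>omega\<^esub> f T"
      using insert by (auto simp: f_def omega_ops dual_def)
    then show ?case
      using insert H a b \<phi> by (simp add: homsD coef_add dual_closed omega_add_closed)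
  qed
  from this[OF finite_exps] have "coef (\<phi> (f exps)) b = 0" by simp
  moreover have "f exps = s"
    by (rule extensionalityI[of _ "carrier alg"])
      (use omegaD(1)[OF s] omega_expand[OF s] in \<open>auto simp: f_def\<close>)
  ultimately show False using nz by simp
qed

section \<open>The canonical trace as an ideal\<close>

lemma trace_zero: "\<zero>\<^bsub>alg\<^esub> \<in> canonical_trace alg"
proof -
  interpret A: cring alg by (rule cring_A_alg)
  have "\<zero>\<^bsub>alg\<^esub> = (\<Oplus>\<^bsub>alg\<^esub>\<phi>\<in>{}. \<phi> (s \<phi>))" for s :: "(('a mpol set \<Rightarrow> 'a) \<Rightarrow> 'a mpol set) \<Rightarrow> 'a mpol set \<Rightarrow> 'a"
    by (rule A.finsum_empty[symmetric])
  then show ?thesis unfolding canonical_trace_def by blast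
qed

text \<open>The defining sums of the trace evaluate each homomorphism at one argument only. If
  \<phi> already occurs, \<open>s\<close> is added to its argument; otherwise a new summand is
  introduced.\<close>

lemma trace_add:
  assumes X: "X \<in> canonical_trace alg" and \<phi>: "\<phi> \<in> homs" and s: "s \<in> carrier omega"
  shows "X \<oplus>\<^bsub>alg\<^esub> \<phi> s \<in> canonical_trace (alg :: ('k::field, 'k mpol set) module)"
proof -
  interpret A: cring "alg :: ('k::field, 'k mpol set) module" by (rule cring_A_alg)
  obtain \<Phi> r where \<Phi>: "finite \<Phi>" "\<Phi> \<subseteq> homs" "r \<in> \<Phi> \<rightarrow> carrier omega"
    and X_eq: "X = (\<Oplus>\<^bsub>alg\<^esub>\<psi>\<in>\<Phi>. \<psi> (r \<psi>))"
    using X unfolding canonical_trace_def by blast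
  have trI: "(\<Oplus>\<^bsub>alg\<^esub>\<psi>\<in>\<Phi>'. \<psi> (r' \<psi>)) \<in> canonical_trace alg"
    if "finite \<Phi>'" "\<Phi>' \<subseteq> homs" "r' \<in> \<Phi>' \<rightarrow> carrier omega" for \<Phi>' r'
    using that unfolding canonical_trace_def by blast
  have cl: "(\<lambda>\<psi>. \<psi> (r \<psi>)) \<in> \<Phi> \<rightarrow> carrier alg" using \<Phi> homsD(1) by blast
  have phis: "\<phi> s \<in> carrier alg" using homsD(1)[OF \<phi> s] .
  define \<Phi>0 where "\<Phi>0 = \<Phi> - {\<phi>}"
  have \<Phi>0: "finite \<Phi>0" "\<phi> \<notin> \<Phi>0" "\<Phi>0 \<subseteq> \<Phi>" using \<Phi> by (auto simp: \<Phi>0_def)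
  define s' where "s' = (if \<phi> \<in> \<Phi> then r \<phi> \<oplus>\<^bsub>omega\<^esub> s else s)"
  have s': "s' \<in> carrier omega" using \<Phi> s by (auto simp: s'_def intro!: omega_add_closed)
  have cl0: "(\<lambda>\<psi>. \<psi> (r \<psi>)) \<in> \<Phi>0 \<rightarrow> carrier alg" using cl \<Phi>0 by auto
  let ?R = "r(\<phi> := s')"
  have eq0: "(\<Oplus>\<^bsub>alg\<^esub>\<psi>\<in>\<Phi>0. \<psi> (?R \<psi>)) = (\<Oplus>\<^bsub>alg\<^esub>\<psi>\<in>\<Phi>0. \<psi> (r \<psi>))"
    using cl0 \<Phi>0 by (intro A.finsum_cong') auto
  have "(\<Oplus>\<^bsub>alg\<^esub>\<psi>\<in>insert \<phi> \<Phi>0. \<psi> (?R \<psi>)) = \<phi> s' \<oplus>\<^bsub>alg\<^esub> (\<Oplus>\<^bsub>alg\<^esub>\<psi>\<in>\<Phi>0. \<psi> (r \<psi>))"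
  proof -
    have "(\<Oplus>\<^bsub>alg\<^esub>\<psi>\<in>insert \<phi> \<Phi>0. \<psi> (?R \<psi>)) = \<phi> (?R \<phi>) \<oplus>\<^bsub>alg\<^esub> (\<Oplus>\<^bsub>alg\<^esub>\<psi>\<in>\<Phi>0. \<psi> (?R \<psi>))"
      using cl0 \<Phi>0 homsD(1)[OF \<phi> s'] by (intro A.finsum_insert) (auto simp: Pi_iff)
    then show ?thesis by (simp only: eq0) simp
  qed
  also have "\<dots> = X \<oplus>\<^bsub>alg\<^esub> \<phi> s"
  proof (cases "\<phi> \<in> \<Phi>")
    case True
    then have r: "r \<phi> \<in> carrier omega" "insert \<phi> \<Phi>0 = \<Phi>" using \<Phi> by (auto simp: \<Phi>0_def)
    have "X = \<phi> (r \<phi>) \<oplus>\<^bsub>alg\<^esub> (\<Oplus>\<^bsub>alg\<^esub>\<psi>\<in>\<Phi>0. \<psi> (r \<psi>))"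
      unfolding X_eq r(2)[symmetric]
      using cl0 \<Phi>0 homsD(1)[OF \<phi> r(1)] by (intro A.finsum_insert) auto
    with True show ?thesis
      using homsD(1,2)[OF \<phi>] r(1) s A.finsum_closed[OF cl0] by (simp add: s'_def A.a_ac)
  next
    case False
    then show ?thesis
      using phis A.finsum_closed[OF cl] by (simp add: s'_def \<Phi>0_def X_eq A.a_comm)
  qed
  finally have eq: "(\<Oplus>\<^bsub>alg\<^esub>\<psi>\<in>insert \<phi> \<Phi>0. \<psi> (?R \<psi>)) = X \<oplus>\<^bsub>alg\<^esub> \<phi> s" .
  have "?R \<in> insert \<phi> \<Phi>0 \<rightarrow> carrier omega"
    using \<Phi>(3) \<Phi>0 s' by auto
  then have "(\<Oplus>\<^bsub>alg\<^esub>\<psi>\<in>insert \<phi> \<Phi>0. \<psi> (?R \<psi>)) \<in> canonical_trace alg"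
    using \<Phi>(2) \<Phi>0 \<phi> by (intro trI) auto
  then show ?thesis unfolding eq .
qed

lemma finsum_coef:
  assumes "finite T" "f \<in> T \<rightarrow> carrier alg" "b \<in> exps"
  shows "coef (\<Oplus>\<^bsub>alg\<^esub>x\<in>T. f x) b = (\<Sum>x\<in>T. coef (f x :: 'k::field mpol set) b)"
proof -
  interpret A: cring "alg :: ('k::field, 'k mpol set) module" by (rule cring_A_alg)
  show ?thesis
    using assms(1,2)
  proof (induction T rule: finite_induct)
    case empty
    then show ?case by (simp add: coef_zero[OF assms(3)])
  next
    case (insert x T)
    then have "f x \<in> carrier alg" "f \<in> T \<rightarrow> carrier alg" by auto
    with insert show ?case
      by (simp add: A.finsum_insert coef_add[OF _ A.finsum_closed assms(3)])
  qed
qed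

text \<open>A nonzero coefficient of a finite sum is nonzero in some summand, and by
  \<open>hom_dual_nonzero\<close> then in the image of some dual form.\<close>

lemma mem_trace_coef:
  assumes X: "X \<in> canonical_trace alg" and b: "b \<in> exps" "coef X b \<noteq> (0 :: 'k::field)"
  shows "\<exists>\<phi>\<in>(homs :: (('k mpol set \<Rightarrow> 'k) \<Rightarrow> 'k mpol set) set). \<exists>a\<in>exps. \<exists>c. coef (\<phi> (dual a c)) b \<noteq> 0"
proof -
  obtain \<Phi> r where \<Phi>: "finite \<Phi>" "\<Phi> \<subseteq> homs" "r \<in> \<Phi> \<rightarrow> carrier omega"
    and X_eq: "X = (\<Oplus>\<^bsub>alg\<^esub>\<psi>\<in>\<Phi>. \<psi> (r \<psi>))"
    using X unfolding canonical_trace_def by blast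
  have "(\<lambda>\<psi>. \<psi> (r \<psi>)) \<in> \<Phi> \<rightarrow> carrier alg" using \<Phi> homsD(1) by blast
  from finsum_coef[OF \<Phi>(1) this b(1)] b(2) obtain \<psi>
    where "\<psi> \<in> \<Phi>" "coef (\<psi> (r \<psi>)) b \<noteq> 0"
    unfolding X_eq by (metis (mono_tags, lifting) sum.neutral)
  with \<Phi> hom_dual_nonzero[of \<psi> "r \<psi>" b] b(1) show ?thesis by blast
qed

text \<open>The homomorphisms used for \<open>X\<close> and for \<open>Y\<close> may overlap, so the
  summands of \<open>Y\<close> are added to \<open>X\<close> one by one with
  \<open>trace_add\<close>.\<close>

lemma trace_add_closed:
  assumes X: "X \<in> canonical_trace alg" and Y: "Y \<in> canonical_trace alg"
  shows "X \<oplus>\<^bsub>alg\<^esub> Y \<in> canonical_trace (alg :: ('k::field, 'k mpol set) module)"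
proof -
  interpret A: cring "alg :: ('k::field, 'k mpol set) module" by (rule cring_A_alg)
  have trace_carrier: "Z \<in> carrier alg" if Z_trace: "Z \<in> canonical_trace alg" for Z :: "'k mpol set"
  proof -
    obtain \<Phi> r where \<Phi>: "\<Phi> \<subseteq> homs" "r \<in> \<Phi> \<rightarrow> carrier omega"
      and Z: "Z = (\<Oplus>\<^bsub>alg\<^esub>\<psi>\<in>\<Phi>. \<psi> (r \<psi>))"
      using Z_trace unfolding canonical_trace_def by blast
    have "(\<lambda>\<psi>. \<psi> (r \<psi>)) \<in> \<Phi> \<rightarrow> carrier alg" using \<Phi> homsD(1) by blast
    then show ?thesis unfolding Z by (rule A.finsum_closed)
  qed
  obtain \<Phi> r where \<Phi>: "finite \<Phi>" "\<Phi> \<subseteq> homs" "r \<in> \<Phi> \<rightarrow> carrier omega"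
    and Y_eq: "Y = (\<Oplus>\<^bsub>alg\<^esub>\<psi>\<in>\<Phi>. \<psi> (r \<psi>))"
    using Y unfolding canonical_trace_def by blast
  have cl: "\<psi> (r \<psi>) \<in> carrier alg" if "\<psi> \<in> \<Phi>" for \<psi> using that \<Phi> homsD(1) by blast
  have "T \<subseteq> \<Phi> \<Longrightarrow> X \<oplus>\<^bsub>alg\<^esub> (\<Oplus>\<^bsub>alg\<^esub>\<psi>\<in>T. \<psi> (r \<psi>)) \<in> canonical_trace alg" if "finite T" for T
    using that
  proof (induction T rule: finite_induct)
    case empty
    then show ?case using X trace_carrier by simp
  next
    case (insert \<psi> T)
    have T: "(\<lambda>\<psi>. \<psi> (r \<psi>)) \<in> T \<rightarrow> carrier alg" using insert.prems cl by blast
    have \<psi>: "\<psi> \<in> homs" "r \<psi> \<in> carrier omega" "\<psi> (r \<psi>) \<in> carrier alg"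
      using insert.prems \<Phi> cl by auto
    have "X \<oplus>\<^bsub>alg\<^esub> (\<Oplus>\<^bsub>alg\<^esub>\<psi>\<in>insert \<psi> T. \<psi> (r \<psi>))
        = (X \<oplus>\<^bsub>alg\<^esub> (\<Oplus>\<^bsub>alg\<^esub>\<psi>\<in>T. \<psi> (r \<psi>))) \<oplus>\<^bsub>alg\<^esub> \<psi> (r \<psi>)"
      using A.finsum_closed[OF T] trace_carrier[OF X] \<psi>(3)
      by (simp add: A.finsum_insert[OF insert.hyps T] A.a_ac)
    then show ?case
      using trace_add[OF insert.IH \<psi>(1,2)] insert.prems by simp
  qed
  from this[OF \<Phi>(1)] show ?thesis by (simp add: Y_eq)
qed

text \<open>By linearity the factor \<open>y\<close> moves into the argument of each
  homomorphism.\<close>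

lemma trace_mult:
  assumes X: "X \<in> canonical_trace alg" and y: "y \<in> carrier alg"
  shows "y \<otimes>\<^bsub>alg\<^esub> X \<in> canonical_trace (alg :: ('k::field, 'k mpol set) module)"
proof -
  interpret A: cring "alg :: ('k::field, 'k mpol set) module" by (rule cring_A_alg)
  obtain \<Phi> r where \<Phi>: "finite \<Phi>" "\<Phi> \<subseteq> homs" "r \<in> \<Phi> \<rightarrow> carrier omega"
    and X_eq: "X = (\<Oplus>\<^bsub>alg\<^esub>\<psi>\<in>\<Phi>. \<psi> (r \<psi>))"
    using X unfolding canonical_trace_def by blast
  have cl: "(\<lambda>\<psi>. \<psi> (r \<psi>)) \<in> \<Phi> \<rightarrow> carrier alg" using \<Phi> homsD(1) by blast
  have eq: "y \<otimes>\<^bsub>alg\<^esub> \<psi> (r \<psi>) = \<psi> (y \<odot>\<^bsub>omega\<^esub> r \<psi>)" if "\<psi> \<in> \<Phi>" for \<psi>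
    using that \<Phi> homsD(3)[of \<psi> y "r \<psi>"] y by auto
  have r: "(\<lambda>\<psi>. y \<odot>\<^bsub>omega\<^esub> r \<psi>) \<in> \<Phi> \<rightarrow> carrier omega"
    using \<Phi> y omega_smult_closed by blast
  have "y \<otimes>\<^bsub>alg\<^esub> X = (\<Oplus>\<^bsub>alg\<^esub>\<psi>\<in>\<Phi>. y \<otimes>\<^bsub>alg\<^esub> \<psi> (r \<psi>))"
    unfolding X_eq by (rule A.finsum_rdistr[OF \<Phi>(1) y cl])
  also have "\<dots> = (\<Oplus>\<^bsub>alg\<^esub>\<psi>\<in>\<Phi>. \<psi> (y \<odot>\<^bsub>omega\<^esub> r \<psi>))"
  proof (rule A.finsum_cong')
    show "(\<lambda>\<psi>. \<psi> (y \<odot>\<^bsub>omega\<^esub> r \<psi>)) \<in> \<Phi> \<rightarrow> carrier alg"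
      using \<Phi>(2) r homsD(1) by blast
  qed (simp_all add: eq)
  moreover have "(\<Oplus>\<^bsub>alg\<^esub>\<psi>\<in>\<Phi>. \<psi> (r' \<psi>)) \<in> canonical_trace alg"
    if "r' \<in> \<Phi> \<rightarrow> carrier omega" for r'
    using that \<Phi>(1,2) unfolding canonical_trace_def by blast
  ultimately show ?thesis using r by simp
qed

section \<open>Which variables lie in the trace\<close>

lemma mon_Var_eq: "mon (Poly_Mapping.single i 1) 1 = cls (Var i)"
  by (simp add: mon_def Var_def)

text \<open>The face is the support of an exponent \<open>a\<close> such that some homomorphism
  sends a dual form at \<open>a\<close> to an element in which \<open>x_i\<close> occurs. Every
  variable outside this support annihilates the dual form, hence its image, and so also
  \<open>x_i\<close>.\<close>

lemma Var_mem_trace_imp: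
  assumes i: "i \<in> {1..m}" and tr: "cls (Var i) \<in> canonical_trace (alg :: ('k::field, 'k mpol set) module)"
  shows "\<exists>F\<in>\<Delta>. (\<forall>j. {i, j} \<in> \<Delta> \<longrightarrow> j \<noteq> i \<longrightarrow> j \<in> F) \<and> (i \<notin> F \<longrightarrow> n i = 2)"
proof -
  interpret A: cring "alg :: ('k::field, 'k mpol set) module" by (rule cring_A_alg)
  let ?e = "\<lambda>j::nat. Poly_Mapping.single j (1::nat)"
  have "coef (cls (Var i) :: 'k mpol set) (?e i) \<noteq> 0"
    using coef_cls[OF Var_in_polys[where 'k='k, OF i] Var_exps[OF i]] by (simp add: Var_def)
  from mem_trace_coef[OF tr Var_exps[OF i] this] obtain \<phi> a c
    where \<phi>: "\<phi> \<in> homs" and a: "a \<in> exps"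
      and nz: "coef (\<phi> (dual a c :: 'k mpol set \<Rightarrow> 'k) :: 'k mpol set) (?e i) \<noteq> 0"
    by blast
  \<comment> \<open>The case \<open>j = i\<close> is included: for \<open>j\<close> distinct from
    \<open>i\<close> the claim says that \<open>j\<close> is not a neighbour of \<open>i\<close>,
    for \<open>j = i\<close> that the square of \<open>x_i\<close> vanishes.\<close>
  have kills: "?e j + ?e i \<notin> exps" if j: "j \<in> {1..m}" "j \<notin> Poly_Mapping.keys a" for j
  proof
    assume in_exps: "?e j + ?e i \<in> exps"
    have keys: "Poly_Mapping.keys (?e j) \<subseteq> {1..m}" using j by simp
    \<comment> \<open>As \<open>x_j\<close> does not divide the monomial of \<open>a\<close>, no
      multiple of \<open>x_j\<close> has a coefficient at \<open>a\<close>, so \<open>x_j\<close>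
      kills the dual form.\<close>
    have "\<nexists>s. a = ?e j + s" using j(2) by (auto simp: in_keys_iff lookup_add)
    moreover have M: "(mon (?e j) 1 :: 'k mpol set) \<in> carrier alg" by (rule mon_carrier[OF keys])
    ultimately have "mon (?e j) 1 \<odot>\<^bsub>omega\<^esub> dual a c = \<zero>\<^bsub>omega\<^esub>"
      unfolding omega_ops by (intro restrict_ext) (simp add: dual_def coef_mon_mult_eq_0[OF _ keys a])
    then have "mon (?e j) 1 \<otimes>\<^bsub>alg\<^esub> \<phi> (dual a c) = \<zero>\<^bsub>alg\<^esub>"
      using homsD(3)[OF \<phi> M dual_closed[OF a]] hom_zero[OF \<phi>] by metis
    \<comment> \<open>If the product of \<open>x_j\<close> and \<open>x_i\<close> were nonzero, its
      coefficient here would be the nonzero coefficient of \<open>x_i\<close> in the image.\<close>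
    moreover have "coef (mon (?e j) 1 \<otimes>\<^bsub>alg\<^esub> \<phi> (dual a c)) (?e j + ?e i)
        = 1 * coef (\<phi> (dual a c)) (?e i)"
      by (rule coef_mon_mult[OF homsD(1)[OF \<phi> dual_closed[OF a]] keys in_exps])
    ultimately show False
      using nz coef_zero[OF in_exps, where ?'a = 'k] by simp
  qed
  show ?thesis
  proof (intro bexI[of _ "Poly_Mapping.keys a"] conjI allI impI)
    fix j assume j: "{i, j} \<in> \<Delta>" "j \<noteq> i"
    then have jm: "j \<in> {1..m}" using face_subset by blast
    have "Poly_Mapping.keys (?e j + ?e i) = {i, j}" by (auto simp: keys_add_nat)
    then have "?e j + ?e i \<in> exps"
      using j two_le by (auto simp: exps_def lookup_add lookup_single when_def dest: two_le)
    then show "j \<in> Poly_Mapping.keys a" using kills jm by blast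
  next
    assume "i \<notin> Poly_Mapping.keys a"
    then have no: "?e i + ?e i \<notin> exps" using kills i by blast
    show "n i = 2"
    proof (rule ccontr)
      assume "n i \<noteq> 2"
      then have "n i > 2" using two_le[OF i] by simp
      moreover have "Poly_Mapping.keys (?e i + ?e i) = {i}" by (simp add: keys_add_nat)
      ultimately have "?e i + ?e i \<in> exps"
        using no_ghost[OF i] by (auto simp: exps_def lookup_add lookup_single when_def dest: two_le)
      with no show False by blast
    qed
  qed (use a in \<open>simp add: exps_def\<close>)
qed

text \<open>The hypothesis \<open>absorb\<close> makes the factors of complementary pairs stable
  under nonzero monomial multiples: whatever multiplies \<open>u\<close> can be taken away from its
  partner \<open>v\<close>. This stability makes the map built from all such pairs linear over
  \<open>alg\<close>.\<close>

lemma Var_mem_trace: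
  assumes a: "a \<in> exps" and i: "i \<in> {1..m}"
    and absorb: "\<And>u v t. \<lbrakk>u \<in> exps; v \<in> exps; u + v = a + Poly_Mapping.single i 1; u + t \<in> exps\<rbrakk>
      \<Longrightarrow> \<exists>w. v = t + w"
  shows "cls (Var i) \<in> canonical_trace (alg :: ('k::field, 'k mpol set) module)"
proof -
  interpret A: cring "alg :: ('k::field, 'k mpol set) module" by (rule cring_A_alg)
  define e where "e = Poly_Mapping.single i (1::nat)"
  define \<delta> where "\<delta> = a + e"
  have e: "e \<in> exps" using Var_exps[OF i] by (simp add: e_def)
  \<comment> \<open>The nonzero monomials with a nonzero complement in \<delta>. The set is
    symmetric under passing to the complement, and on it the truncated difference from \<delta> is
    exact.\<close>
  define S where "S = {v \<in> exps. \<exists>u\<in>exps. u + v = \<delta>}"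
  have S_exps: "S \<subseteq> exps" by (auto simp: S_def)
  have finS: "finite S" using finite_subset[OF S_exps finite_exps] .
  have S_diff: "\<delta> - v \<in> S \<and> \<delta> - v + v = \<delta>" if "v \<in> S" for v
    using that by (auto simp: S_def add.commute)
  have S_add: "u + t \<in> S" if "u \<in> S" "u + t \<in> exps" for u t
  proof -
    from that obtain v where v: "v \<in> exps" "u + v = \<delta>" "u \<in> exps"
      by (auto simp: S_def add.commute)
    from absorb[of u v t] v that obtain w where w: "v = t + w"
      unfolding \<delta>_def e_def by blast
    have "w + (u + t) = \<delta>" using w v by (simp add: add_ac)
    moreover have "w \<in> exps" using w v exps_down' by blast
    ultimately show ?thesis using that(2) unfolding S_def by blast
  qed
  \<comment> \<open>Each monomial in \<open>S\<close> receives as coefficient the value of the form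
    at the complementary monomial.\<close>
  define \<phi> where "\<phi> s = cls (\<Sum>v\<in>S. Poly_Mapping.single v (s (mon (\<delta> - v) 1 :: 'k mpol set)) :: 'k mpol)" for s
  have polys: "(\<Sum>v\<in>S. Poly_Mapping.single v (s (mon (\<delta> - v) 1 :: 'k mpol set)) :: 'k mpol) \<in> polys" for s
    using S_exps exps_keys by (intro sum_in_polys single_in_polys) blast
  have \<phi>_carrier: "\<phi> s \<in> carrier alg" for s
    using polys by (simp add: \<phi>_def alg_ops)
  have coef_\<phi>: "coef (\<phi> s) b = (if b \<in> S then s (mon (\<delta> - b) 1) else 0)" if "b \<in> exps" for s b
    using that finS by (simp add: \<phi>_def coef_cls polys lookup_sum lookup_single when_def)
  have \<phi>_add: "\<phi> (s \<oplus>\<^bsub>omega\<^esub> s') = \<phi> s \<oplus>\<^bsub>alg\<^esub> \<phi> s'" for s s'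
  proof (rule alg_eqI)
    fix b assume b: "b \<in> exps"
    show "coef (\<phi> (s \<oplus>\<^bsub>omega\<^esub> s')) b = coef (\<phi> s \<oplus>\<^bsub>alg\<^esub> \<phi> s') b"
    proof (cases "b \<in> S")
      case True
      then have "mon (\<delta> - b) 1 \<in> carrier (alg :: ('k, 'k mpol set) module)"
        using S_diff S_exps mon_exps_carrier by blast
      with True b show ?thesis by (simp add: coef_add \<phi>_carrier coef_\<phi> omega_ops)
    qed (use b in \<open>simp add: coef_add \<phi>_carrier coef_\<phi>\<close>)
  qed (simp_all add: \<phi>_carrier)
  have \<phi>_mon: "\<phi> (mon t c \<odot>\<^bsub>omega\<^esub> s) = mon t c \<otimes>\<^bsub>alg\<^esub> \<phi> s"
    if t: "t \<in> exps" and s: "s \<in> carrier omega" for t c s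
  proof (rule alg_eqI)
    fix b assume b: "b \<in> exps"
    note tk = exps_keys[OF t]
    have lhs: "coef (\<phi> (mon t c \<odot>\<^bsub>omega\<^esub> s)) b = s (mon (t + (\<delta> - b)) c)" if "b \<in> S"
    proof -
      have k: "\<delta> - b \<in> exps" using S_diff[OF that] S_exps by blast
      show ?thesis
        using that b k
        by (simp add: coef_\<phi> omega_ops mon_exps_carrier mon_mult[OF tk exps_keys[OF k]])
    qed
    show "coef (\<phi> (mon t c \<odot>\<^bsub>omega\<^esub> s)) b = coef (mon t c \<otimes>\<^bsub>alg\<^esub> \<phi> s) b"
    \<comment> \<open>If \<open>b = t + w\<close> with \<open>w\<close> in \<open>S\<close>, both
      coefficients are the value of \<open>s\<close> at the complement of \<open>w\<close>, scaled
      by \<open>c\<close>. Otherwise both vanish.\<close>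
    proof (cases "\<exists>w\<in>S. b = t + w")
      case True
      then obtain w where w: "w \<in> S" "b = t + w" by blast
      then have bS: "b \<in> S" using S_add[of w t] b by (simp add: add.commute)
      have "t + (\<delta> - b) = \<delta> - w"
      proof -
        have "t + (\<delta> - b) + w = \<delta>" using S_diff[OF bS] w(2) by (simp add: add_ac)
        then show ?thesis by (metis add_diff_cancel_right')
      qed
      moreover have "Poly_Mapping.keys (\<delta> - w) \<subseteq> {1..m}"
        using S_diff[OF w(1)] S_exps exps_keys by blast
      moreover have "coef (mon t c \<otimes>\<^bsub>alg\<^esub> \<phi> s) (t + w) = c * coef (\<phi> s) w"
        using b by (intro coef_mon_mult[OF \<phi>_carrier tk]) (simp add: w)
      moreover have "w \<in> exps" using w S_exps by blast
      ultimately show ?thesis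
        using w lhs[OF bS] omega_mon[OF s, of "\<delta> - w" c] by (simp add: coef_\<phi>)
    next
      case False
      have "coef (mon t c \<otimes>\<^bsub>alg\<^esub> \<phi> s) b = 0"
      proof (cases "\<exists>w. b = t + w")
        case True
        then obtain w where w: "b = t + w" by blast
        have "w \<in> exps" using b w exps_down' by blast
        moreover have "w \<notin> S" using False w by blast
        ultimately show ?thesis
          using b unfolding w by (simp add: coef_mon_mult[OF \<phi>_carrier tk] coef_\<phi>)
      qed (use b coef_mon_mult_eq_0[OF \<phi>_carrier tk] in blast)
      moreover have "coef (\<phi> (mon t c \<odot>\<^bsub>omega\<^esub> s)) b = 0"
      proof (cases "b \<in> S")
        case bS: True
        \<comment> \<open>If this product were nonzero, it would lie in \<open>S\<close> by
          \<open>S_add\<close>, and its complement \<open>w\<close> would satisfy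
          \<open>b = t + w\<close>, contrary to the case.\<close>
        have "t + (\<delta> - b) \<notin> exps"
        proof
          assume "t + (\<delta> - b) \<in> exps"
          then have *: "\<delta> - b + t \<in> S" using S_add[of "\<delta> - b" t] S_diff[OF bS] by (simp add: add.commute)
          define w where "w = \<delta> - (\<delta> - b + t)"
          have "w \<in> S" "w + (\<delta> - b + t) = \<delta>" using S_diff[OF *] by (simp_all add: w_def)
          moreover have "\<delta> = b + (\<delta> - b)" using S_diff[OF bS] by (simp add: add.commute)
          ultimately have "t + w + (\<delta> - b) = b + (\<delta> - b)" by (simp add: add_ac)
          then have "b = t + w" by (metis add_right_cancel)
          with False \<open>w \<in> S\<close> show False by blast
        qed
        moreover have "Poly_Mapping.keys (t + (\<delta> - b)) \<subseteq> {1..m}"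
          using tk S_diff[OF bS] S_exps exps_keys unfolding keys_add_nat by blast
        ultimately show ?thesis
          using lhs[OF bS] omega_zero[OF s] by (simp add: mon_eq_zero)
      qed (use b in \<open>simp add: coef_\<phi>\<close>)
      ultimately show ?thesis by simp
    qed
  qed (use t in \<open>simp_all add: \<phi>_carrier mon_exps_carrier\<close>)
  have \<phi>_mult: "\<phi> (x \<odot>\<^bsub>omega\<^esub> s) = x \<otimes>\<^bsub>alg\<^esub> \<phi> s"
    if x: "x \<in> carrier alg" and s: "s \<in> carrier omega" for x s
    using x
  proof (induction x rule: alg_induct)
    case zero
    \<comment> \<open>An element equal to its own double is zero, so additivity alone settles this
      case.\<close>
    have 1: "\<phi> (\<zero>\<^bsub>alg\<^esub> \<odot>\<^bsub>omega\<^esub> s) \<oplus>\<^bsub>alg\<^esub> \<phi> (\<zero>\<^bsub>alg\<^esub> \<odot>\<^bsub>omega\<^esub> s) = \<phi> (\<zero>\<^bsub>alg\<^esub> \<odot>\<^bsub>omega\<^esub> s)"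
    proof -
      have "(\<zero>\<^bsub>alg\<^esub> \<odot>\<^bsub>omega\<^esub> s) \<oplus>\<^bsub>omega\<^esub> (\<zero>\<^bsub>alg\<^esub> \<odot>\<^bsub>omega\<^esub> s) = \<zero>\<^bsub>alg\<^esub> \<odot>\<^bsub>omega\<^esub> s"
        by (auto simp: omega_ops omega_zero[OF s])
      then show ?thesis by (metis \<phi>_add)
    qed
    then show ?case
      using \<phi>_carrier by (metis A.add.l_cancel_one A.l_null)
  next
    case (add Y t)
    let ?M = "mon t (coef x t)"
    have M: "?M \<in> carrier alg" using add.hyps by (simp add: mon_exps_carrier)
    have "(Y \<oplus>\<^bsub>alg\<^esub> ?M) \<odot>\<^bsub>omega\<^esub> s = (Y \<odot>\<^bsub>omega\<^esub> s) \<oplus>\<^bsub>omega\<^esub> (?M \<odot>\<^bsub>omega\<^esub> s)"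
      using add.hyps(1) M by (auto simp: omega_ops A.l_distr omegaD(2)[OF s])
    then show ?case
      using add.IH \<phi>_mon[OF add.hyps(2) s] add.hyps(1) M \<phi>_carrier by (simp add: \<phi>_add A.l_distr)
  qed
  have "\<phi> \<in> homs"
    using \<phi>_carrier \<phi>_add \<phi>_mult by (simp add: module_homs_def regular_module_def)
  from trace_add[OF trace_zero this dual_closed[OF a], of 1]
  have "\<phi> (dual a 1) \<in> canonical_trace alg" using \<phi>_carrier by simp
  moreover have "\<phi> (dual a 1) = mon e 1"
  proof (rule alg_eqI)
    fix b assume b: "b \<in> exps"
    \<comment> \<open>Only the pair formed by \<open>a\<close> and \<open>e\<close> contributes,
      because the dual form at \<open>a\<close> vanishes on every other monomial of the
      basis.\<close>
    have "(b \<in> S \<and> \<delta> - b = a) = (b = e)"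
    proof
      assume *: "b \<in> S \<and> \<delta> - b = a"
      then have "a + b = \<delta>" using S_diff by blast
      then show "b = e" by (simp add: \<delta>_def)
    next
      assume "b = e"
      then show "b \<in> S \<and> \<delta> - b = a" using a e by (auto simp: S_def \<delta>_def)
    qed
    moreover have "dual a (1::'k) (mon (\<delta> - b) 1) = (if \<delta> - b = a then 1 else 0)" if "b \<in> S"
    proof -
      have "\<delta> - b \<in> exps" using S_diff[OF that] S_exps by blast
      then show ?thesis
        using coef_mon[OF exps_keys, of "\<delta> - b" a "1::'k"] a by (auto simp: dual_def mon_exps_carrier)
    qed
    ultimately show "coef (\<phi> (dual a 1)) b = coef (mon e 1 :: 'k mpol set) b"
      using b by (auto simp: coef_\<phi> coef_mon[OF exps_keys[OF e]])
  qed (use e in \<open>simp_all add: \<phi>_carrier mon_exps_carrier\<close>)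
  ultimately show ?thesis by (simp add: e_def mon_Var_eq)
qed

text \<open>The trace is an ideal and the variables generate the graded maximal ideal: its elements
  have no constant term, so every monomial occurring in them is divisible by some variable.\<close>

lemma nearly_gorenstein_iff_Var:
  "nearly_gorenstein (alg :: ('k::field, 'k mpol set) module) (A_grading m \<Delta> n) \<longleftrightarrow>
    (\<forall>i\<in>{1..m}. cls (Var i :: 'k mpol) \<in> canonical_trace alg)"
proof -
  interpret A: cring "alg :: ('k::field, 'k mpol set) module" by (rule cring_A_alg)
  have grading: "A_grading m \<Delta> n d = cls ` {p \<in> polys. homogeneous d (p :: 'k mpol)}" for d
    by (simp add: A_grading_def cls_def carrier_poly_ring)
  show ?thesis
  proof
    assume ng: "nearly_gorenstein (alg :: ('k, 'k mpol set) module) (A_grading m \<Delta> n)"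
    show "\<forall>i\<in>{1..m}. cls (Var i :: 'k mpol) \<in> canonical_trace alg"
    proof
      fix i assume i: "i \<in> {1..m}"
      have "homogeneous 1 (Var i :: 'k mpol)"
        by (simp add: homogeneous_def Var_def monom_degree_def)
      then have gr: "cls (Var i :: 'k mpol) \<in> A_grading m \<Delta> n 1"
        using Var_in_polys[where 'k='k, OF i] by (simp add: grading)
      have "cls (Var i :: 'k mpol) = (\<Oplus>\<^bsub>alg\<^esub>d\<in>{1::nat}. cls (Var i))"
        using Var_in_polys[where 'k='k, OF i] by (simp add: A.finsum_insert alg_ops(1))
      moreover have "(\<lambda>_. cls (Var i :: 'k mpol)) \<in> Pi {1} (A_grading m \<Delta> n)"
        using gr by simp
      moreover have "finite {1::nat}" "0 \<notin> {1::nat}" by simp_all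
      ultimately have "cls (Var i :: 'k mpol) \<in> graded_max_ideal alg (A_grading m \<Delta> n)"
        unfolding graded_max_ideal_def by blast
      with ng show "cls (Var i :: 'k mpol) \<in> canonical_trace alg"
        unfolding nearly_gorenstein_def by blast
    qed
  next
    assume vars: "\<forall>i\<in>{1..m}. cls (Var i :: 'k mpol) \<in> canonical_trace alg"
    show "nearly_gorenstein (alg :: ('k, 'k mpol set) module) (A_grading m \<Delta> n)"
      unfolding nearly_gorenstein_def
    proof
      fix X :: "'k mpol set" assume "X \<in> graded_max_ideal alg (A_grading m \<Delta> n)"
      then obtain D f where D: "finite D" "0 \<notin> D" "f \<in> Pi D (A_grading m \<Delta> n)"
        and X: "X = (\<Oplus>\<^bsub>alg\<^esub>d\<in>D. f d)"
        unfolding graded_max_ideal_def by blast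
      have f: "f \<in> D \<rightarrow> carrier alg"
        using D(3) unfolding Pi_iff grading alg_ops(1) by blast
      have X_carrier: "X \<in> carrier alg" unfolding X by (rule A.finsum_closed[OF f])
      have "coef (f d) 0 = 0" if d: "d \<in> D" for d
      proof -
        obtain p where p: "p \<in> polys" "homogeneous d p" "f d = cls p"
          using D(3) d unfolding Pi_iff grading by blast
        \<comment> \<open>The exponent 0 has degree 0 and therefore cannot occur in a homogeneous
          polynomial of positive degree.\<close>
        have "d \<noteq> 0" using d D(2) by metis
        then have "0 \<notin> Poly_Mapping.keys p"
          using p(2) by (force simp: homogeneous_def monom_degree_def)
        then show ?thesis using p by (simp add: coef_cls zero_exps in_keys_iff)
      qed
      then have X0: "coef X 0 = 0"
        unfolding X by (simp add: finsum_coef[OF D(1) f zero_exps])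
      show "X \<in> canonical_trace alg"
        using X_carrier
      proof (induction X rule: alg_induct)
        case zero
        show ?case by (rule trace_zero)
      next
        case (add Y t)
        have "t \<noteq> 0" using add.hyps(3) X0 by auto
        then obtain i where i: "i \<in> Poly_Mapping.keys t"
          by (metis ex_in_conv keys_eq_empty)
        then have im: "i \<in> {1..m}" using exps_keys[OF add.hyps(2)] by blast
        have "\<exists>s. t = (\<Sum>j\<in>{i}. Poly_Mapping.single j 1) + s"
          using i by (intro sum_single_add_diff) (auto simp: in_keys_iff)
        then obtain s where s: "t = s + Poly_Mapping.single i 1" by (auto simp: add.commute)
        then have se: "s \<in> exps" using add.hyps(2) exps_down by blast
        have "mon t (coef X t) = mon s (coef X t) \<otimes>\<^bsub>alg\<^esub> mon (Poly_Mapping.single i 1) 1"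
          using mon_mult[OF exps_keys[OF se] exps_keys[OF Var_exps[OF im]], of "coef X t" 1] s
          by simp
        then have "mon t (coef X t) = mon s (coef X t) \<otimes>\<^bsub>alg\<^esub> cls (Var i)"
          by (simp only: mon_Var_eq)
        moreover have "\<dots> \<in> canonical_trace alg"
          using vars im by (intro trace_mult mon_exps_carrier se) blast
        ultimately show ?case
          using add.IH by (simp add: trace_add_closed)
      qed
    qed
  qed
qed

subsection \<open>Connected components of the one-skeleton\<close>

abbreviation comps :: "nat set set" where
  "comps \<equiv> connected_components (one_skeleton m \<Delta>)"

lemma fst_one_skeleton: "fst (one_skeleton m \<Delta>) = {1..m}"
  using no_ghost by (auto simp: one_skeleton_def ghost_vertex_def)

lemma edge_iff: "{a, b} \<in> snd (one_skeleton m \<Delta>) \<longleftrightarrow> {a, b} \<in> \<Delta> \<and> a \<noteq> b"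
  by (auto simp: one_skeleton_def card_2_iff doubleton_eq_iff)

text \<open>Connectivity in the one-skeleton once the absence of ghost vertices has identified the
  vertex set with \<open>{1..m}\<close>.\<close>

definition reach :: "(nat \<times> nat) set" where
  "reach = {(u, v) \<in> {1..m} \<times> {1..m}. (u, v) \<in> {(a, b). {a, b} \<in> \<Delta> \<and> a \<noteq> b}\<^sup>*}"

lemma comps_eq: "comps = {1..m} // reach"
  by (simp add: connected_components_def fst_one_skeleton edge_iff reach_def)

lemma equiv_reach: "equiv {1..m} reach"
proof (rule equivI)
  have "sym {(a, b). {a, b} \<in> \<Delta> \<and> a \<noteq> b}" by (auto simp: sym_def insert_commute)
  from sym_rtrancl[OF this] show "sym reach" by (auto simp: reach_def sym_def)
  show "trans reach" by (auto simp: reach_def intro: transI rtrancl_trans)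
qed (auto simp: reach_def refl_on_def)

lemma comp_subset: "K \<in> comps \<Longrightarrow> K \<subseteq> {1..m}"
  unfolding comps_eq by (metis Union_quotient Union_upper equiv_reach)

lemma comp_nonempty: "K \<in> comps \<Longrightarrow> K \<noteq> {}"
  unfolding comps_eq using in_quotient_imp_non_empty[OF equiv_reach] .

lemma ex_comp: "i \<in> {1..m} \<Longrightarrow> \<exists>K\<in>comps. i \<in> K"
  unfolding comps_eq by (metis Union_quotient UnionE equiv_reach)

text \<open>The degenerate case \<open>u = v\<close> is covered by reflexivity, so two vertices of a
  common face need not be checked for distinctness.\<close>

lemma comp_edge:
  assumes "K \<in> comps" "u \<in> K" "{u, v} \<in> \<Delta>"
  shows "v \<in> K"
proof -
  have "(u, v) \<in> reach"
    using face_subset[OF assms(3)] assms(3) by (auto simp: reach_def)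
  then show ?thesis
    using assms(1,2) in_quotient_imp_closed[OF equiv_reach] unfolding comps_eq by blast
qed

text \<open>A property is carried along a path from \<open>u\<close> to \<open>v\<close>; by
  \<open>comp_edge\<close> the path never leaves the component.\<close>

lemma comp_induct [consumes 3, case_names base edge]:
  assumes K: "K \<in> comps" "u \<in> K" "v \<in> K"
    and base: "P u"
    and edge: "\<And>a b. \<lbrakk>a \<in> K; b \<in> K; {a, b} \<in> \<Delta>; a \<noteq> b; P a\<rbrakk> \<Longrightarrow> P b"
  shows "P v"
proof -
  have "(u, v) \<in> reach"
    using K quotient_eq_iff[OF equiv_reach] unfolding comps_eq by blast
  then have "(u, v) \<in> {(a, b). {a, b} \<in> \<Delta> \<and> a \<noteq> b}\<^sup>*" by (simp add: reach_def)
  then have "v \<in> K \<and> P v"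
  proof (induction rule: rtrancl_induct)
    case base
    show ?case using K assms(4) by simp
  next
    case (step a b)
    then show ?case using edge[of a b] comp_edge[OF K(1)] by auto
  qed
  then show ?thesis by simp
qed

text \<open>The two outcomes are separated by whether all closed neighbourhoods in \<open>K\<close>
  are faces. Either behaviour spreads along edges, and it determines all of \<open>K\<close> by
  connectedness.\<close>

lemma comp_simplex_or_boundary:
  assumes loc: "\<And>i. i \<in> {1..m} \<Longrightarrow>
      \<exists>F\<in>\<Delta>. (\<forall>j. {i, j} \<in> \<Delta> \<longrightarrow> j \<noteq> i \<longrightarrow> j \<in> F) \<and> (i \<notin> F \<longrightarrow> n i = 2)"
    and K: "K \<in> comps"
  shows "induced_subcomplex \<Delta> K = full_simplex K \<or>
    (induced_subcomplex \<Delta> K = boundary_simplex K \<and> (\<forall>i\<in>K. n i = 2))"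
proof -
  \<comment> \<open>Closed neighbourhoods: \<open>i\<close> itself belongs to \<open>N i\<close>
    because there are no ghost vertices.\<close>
  define N where "N i = {j. {i, j} \<in> \<Delta>}" for i
  have self: "i \<in> N i" if "i \<in> {1..m}" for i using no_ghost[OF that] by (simp add: N_def)
  have face_N: "F \<subseteq> N i" if "F \<in> \<Delta>" "i \<in> F" for F i
    using that subset_face by (auto simp: N_def)
  obtain i0 where i0: "i0 \<in> K" using comp_nonempty[OF K] by blast
  have Km: "K \<subseteq> {1..m}" using comp_subset[OF K] .
  show ?thesis
  proof (cases "\<forall>i\<in>K. N i \<in> \<Delta>")
    case True
    \<comment> \<open>If \<open>a\<close> and \<open>b\<close> are adjacent, then \<open>N a\<close>
      is a face containing \<open>b\<close>, hence contained in \<open>N b\<close>, and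
      conversely.\<close>
    have "N j = N i0" if "j \<in> K" for j
      using K i0 that
    proof (induction rule: comp_induct)
      case (edge a b)
      have "b \<in> N a" "a \<in> N b" using edge.hyps by (simp_all add: N_def insert_commute)
      then have "N a \<subseteq> N b" "N b \<subseteq> N a"
        using True edge.hyps face_N by blast+
      with edge.IH show ?case by blast
    qed simp
    then have "K \<subseteq> N i0" using self Km by blast
    then have "K \<in> \<Delta>" using True i0 subset_face by blast
    then have "induced_subcomplex \<Delta> K = full_simplex K"
      using subset_face by (auto simp: induced_subcomplex_def full_simplex_def)
    then show ?thesis ..
  next
    case False
    then obtain i1 where i1: "i1 \<in> K" "N i1 \<notin> \<Delta>" by blast
    from loc have "\<exists>f. \<forall>i\<in>{1..m}. f i \<in> \<Delta> \<and> N i \<subseteq> insert i (f i) \<and> (i \<notin> f i \<longrightarrow> n i = 2)"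
      unfolding N_def by (intro bchoice) blast
    then obtain f where f: "\<And>i. i \<in> {1..m} \<Longrightarrow> f i \<in> \<Delta>"
      "\<And>i. i \<in> {1..m} \<Longrightarrow> N i \<subseteq> insert i (f i)"
      "\<And>i. i \<in> {1..m} \<Longrightarrow> i \<notin> f i \<Longrightarrow> n i = 2" by blast
    \<comment> \<open>The set \<open>insert i (f i)\<close> contains the non-face
      \<open>N i\<close>, so it is not a face; as \<open>f i\<close> is one, it must omit
      \<open>i\<close>.\<close>
    have non: "insert i (f i) \<notin> \<Delta>" "i \<notin> f i" if "i \<in> {1..m}" "N i \<notin> \<Delta>" for i
    proof -
      show "insert i (f i) \<notin> \<Delta>" using f(2)[OF that(1)] that(2) subset_face by blast
      then show "i \<notin> f i" using f(1)[OF that(1)] by (auto simp: insert_absorb)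
    qed
    \<comment> \<open>For an edge from \<open>a\<close> to \<open>b\<close>, the face
      \<open>f a\<close> contains \<open>b\<close>, so \<open>N b\<close> contains the non-face
      \<open>insert a (f a)\<close>.\<close>
    have bad: "N j \<notin> \<Delta>" if "j \<in> K" for j
      using K i1(1) that
    proof (induction rule: comp_induct)
      case base
      show ?case by (rule i1(2))
    next
      case (edge a b)
      have am: "a \<in> {1..m}" using edge Km by blast
      have "b \<in> f a" using f(2)[OF am] edge by (auto simp: N_def)
      then have "insert a (f a) \<subseteq> N b"
        using face_N[OF f(1)[OF am]] edge by (auto simp: N_def insert_commute)
      then show ?case using non(1)[OF am edge.IH] subset_face by blast
    qed
    have C: "insert j (f j) = insert i0 (f i0)" if "j \<in> K" for j
      using K i0 that
    proof (induction rule: comp_induct)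
      case (edge a b)
      \<comment> \<open>The same containment in \<open>N b\<close>, followed by \<open>N b\<close>
        lying in \<open>insert b (f b)\<close>; exchanging \<open>a\<close> and \<open>b\<close>
        gives equality.\<close>
      have sub: "insert a (f a) \<subseteq> insert b (f b)"
        if ab: "a \<in> K" "b \<in> K" "{a, b} \<in> \<Delta>" "a \<noteq> b" for a b
      proof -
        have m: "a \<in> {1..m}" "b \<in> {1..m}" using ab Km by auto
        have "b \<in> f a" using f(2)[OF m(1)] ab by (auto simp: N_def)
        then have "insert a (f a) \<subseteq> N b"
          using face_N[OF f(1)[OF m(1)]] ab by (auto simp: N_def insert_commute)
        then show ?thesis using f(2)[OF m(2)] by blast
      qed
      have "insert a (f a) = insert b (f b)"
        using sub[of a b] sub[of b a] edge by (auto simp: insert_commute)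
      with edge.IH show ?case by simp
    qed simp
    have CK: "insert i0 (f i0) = K"
    proof
      show "K \<subseteq> insert i0 (f i0)" using C by blast
      have i0m: "i0 \<in> {1..m}" using i0 Km by blast
      \<comment> \<open>Since \<open>{i0}\<close> is a face and \<open>N i0\<close> is not, there is
        a neighbour \<open>l\<close>. It lies in \<open>f i0\<close>, so the whole face
        \<open>f i0\<close> belongs to the component of \<open>l\<close>.\<close>
      have "N i0 \<noteq> {i0}" using bad[OF i0] no_ghost[OF i0m] by metis
      then obtain l where l: "l \<in> N i0" "l \<noteq> i0" using self[OF i0m] by blast
      then have lf: "l \<in> f i0" using f(2)[OF i0m] by blast
      have "l \<in> K" using comp_edge[OF K i0, of l] l by (simp add: N_def)
      moreover have "f i0 \<subseteq> N l" using face_N[OF f(1)[OF i0m] lf] .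
      ultimately have "f i0 \<subseteq> K" using comp_edge[OF K] by (auto simp: N_def)
      then show "insert i0 (f i0) \<subseteq> K" using i0 by simp
    qed
    have K_not: "K \<notin> \<Delta>" using non(1)[of i0] bad[OF i0] i0 Km CK by auto
    have rem: "K - {j} \<in> \<Delta>" if "j \<in> K" for j
    proof -
      \<comment> \<open>Every vertex can serve as the omitted one because
        \<open>insert j (f j)\<close> is \<open>K\<close> for each \<open>j\<close> in
        \<open>K\<close>.\<close>
      have "K - {j} = f j" using C[OF that] CK non(2)[of j] bad[OF that] that Km by auto
      then show ?thesis using f(1)[of j] that Km by auto
    qed
    have "induced_subcomplex \<Delta> K = boundary_simplex K"
    proof (intro equalityI subsetI)
      fix F assume "F \<in> boundary_simplex K"
      then obtain j where "j \<in> K" "F \<subseteq> K - {j}" "F \<subseteq> K" by (auto simp: boundary_simplex_def)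
      then show "F \<in> induced_subcomplex \<Delta> K"
        using subset_face[OF rem, of j F] by (simp add: induced_subcomplex_def)
    qed (use K_not in \<open>auto simp: induced_subcomplex_def boundary_simplex_def\<close>)
    moreover have "\<forall>i\<in>K. n i = 2" using f(3) non(2) bad Km by blast
    ultimately show ?thesis by blast
  qed
qed

section \<open>The largest nonzero monomial supported on a face\<close>

definition top_exp :: "nat set \<Rightarrow> nat \<Rightarrow>\<^sub>0 nat" where
  "top_exp F = (\<Sum>i\<in>F. Poly_Mapping.single i (n i - 1))"

lemma lookup_top_exp: "finite F \<Longrightarrow> Poly_Mapping.lookup (top_exp F) i = (if i \<in> F then n i - 1 else 0)"
  by (simp add: top_exp_def lookup_sum lookup_single when_def)

text \<open>The bound \<open>2 \<le> n i\<close> makes each exponent \<open>n i - 1\<close>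
  positive.\<close>

lemma keys_top_exp:
  assumes "F \<in> \<Delta>" shows "Poly_Mapping.keys (top_exp F) = F"
  using face_subset[OF assms] finite_face[OF assms] two_le
  by (fastforce simp: in_keys_iff lookup_top_exp split: if_splits)

lemma top_exp_exps: "F \<in> \<Delta> \<Longrightarrow> top_exp F \<in> exps"
  using two_le
  by (auto simp: exps_def keys_top_exp lookup_top_exp finite_face dest: two_le)

text \<open>Treats both cases at once: \<open>F = K\<close> for a simplex and
  \<open>F = K - {i}\<close> for a boundary. It verifies the \<open>absorb\<close> condition of
  \<open>Var_mem_trace\<close> one exponent at a time.\<close>

lemma Var_mem_trace_top:
  assumes K: "K \<in> comps" and F: "F \<in> \<Delta>" "insert i F = K"
    and not_exp: "top_exp F + Poly_Mapping.single i 1 \<notin> exps"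
    and ni: "i \<notin> F \<Longrightarrow> n i = 2"
  shows "cls (Var i) \<in> canonical_trace (alg :: ('k::field, 'k mpol set) module)"
proof (rule Var_mem_trace)
  show "top_exp F \<in> exps" using top_exp_exps[OF F(1)] .
  show im: "i \<in> {1..m}" using comp_subset[OF K] F(2) by blast
  fix u v t
  assume u: "u \<in> exps" and v: "v \<in> exps" and uv: "u + v = top_exp F + Poly_Mapping.single i 1"
    and ut: "u + t \<in> exps"
  have uv_l: "Poly_Mapping.lookup u j + Poly_Mapping.lookup v j =
      (if j \<in> F then n j - 1 else 0) + (if j = i then 1 else 0)" for j
    using arg_cong[OF uv, of "\<lambda>x. Poly_Mapping.lookup x j"] finite_face[OF F(1)]
    by (simp add: lookup_add lookup_top_exp lookup_single when_def)
  \<comment> \<open>For \<open>u = 0\<close> the factor \<open>v\<close> would be the whole product,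
    which is zero in the algebra. A vertex \<open>k\<close> in the support of \<open>u\<close> then
    ties the variables of \<open>t\<close> to the component.\<close>
  have "u \<noteq> 0" using not_exp uv v by auto
  then obtain k where k: "k \<in> Poly_Mapping.keys u" by (metis ex_in_conv keys_eq_empty)
  then have kK: "k \<in> K" using uv_l[of k] F(2) by (auto simp: in_keys_iff split: if_splits)
  have le: "Poly_Mapping.lookup t j \<le> Poly_Mapping.lookup v j" for j
  proof (cases "Poly_Mapping.lookup t j = 0")
    case False
    then have "j \<in> Poly_Mapping.keys (u + t)" "k \<in> Poly_Mapping.keys (u + t)"
      using k by (auto simp: keys_add_nat in_keys_iff)
    then have "{k, j} \<in> \<Delta>" using ut subset_face by (auto simp: exps_def)
    then have jK: "j \<in> K" using comp_edge[OF K kK] by blast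
    then have jm: "j \<in> {1..m}" using comp_subset[OF K] by blast
    have "Poly_Mapping.lookup u j + Poly_Mapping.lookup t j < n j"
      using ut jm by (simp add: exps_def lookup_add)
    \<comment> \<open>If \<open>j\<close> is outside \<open>F\<close>, then \<open>j = i\<close> and
      \<open>n i = 2\<close>, so the single extra factor \<open>x_i\<close> already reaches
      \<open>n j - 1\<close>. Thus the room left above the exponent of \<open>u\<close> is at most
      the exponent of \<open>v\<close>.\<close>
    moreover have "n j - 1 \<le> Poly_Mapping.lookup u j + Poly_Mapping.lookup v j"
      using uv_l[of j] jK F(2) ni by (auto split: if_splits)
    ultimately show ?thesis by simp
  qed simp
  show "\<exists>w. v = t + w"
    by (rule exI[of _ "v - t"], rule poly_mapping_eqI) (simp add: lookup_add lookup_minus le)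
qed

end

section \<open>The equivalence for the whole complex\<close>

theorem corollaryB:
  fixes m :: nat and \<Delta> :: "nat set set" and n :: "nat \<Rightarrow> nat"
  assumes "simplicial_complex m \<Delta>"
    and "\<forall>i\<in>{1..m}. \<not> ghost_vertex m \<Delta> i"
    and "\<forall>i\<in>{1..m}. 2 \<le> n i"
  shows "nearly_gorenstein (A_alg m \<Delta> n :: ('k::field, 'k mpol set) module) (A_grading m \<Delta> n)
    \<longleftrightarrow> (\<forall>C \<in> connected_components (one_skeleton m \<Delta>).
          induced_subcomplex \<Delta> C = full_simplex C
          \<or> (induced_subcomplex \<Delta> C = boundary_simplex C \<and> (\<forall>i\<in>C. n i = 2)))"
proof -
  interpret powers_complex m \<Delta> n
    using assms by unfold_locales (auto simp: ghost_vertex_def)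
  have "(\<forall>i\<in>{1..m}. cls (Var i :: 'k mpol) \<in> canonical_trace alg) \<longleftrightarrow>
      (\<forall>C\<in>comps. induced_subcomplex \<Delta> C = full_simplex C
        \<or> (induced_subcomplex \<Delta> C = boundary_simplex C \<and> (\<forall>i\<in>C. n i = 2)))" (is "?L \<longleftrightarrow> ?R")
  proof
    assume ?L
    show ?R
    proof
      fix C assume "C \<in> comps"
      then show "induced_subcomplex \<Delta> C = full_simplex C
          \<or> (induced_subcomplex \<Delta> C = boundary_simplex C \<and> (\<forall>i\<in>C. n i = 2))"
        using \<open>?L\<close> Var_mem_trace_imp by (intro comp_simplex_or_boundary) blast+
    qed
  next
    assume R: ?R
    show ?L
    proof
      fix i assume i: "i \<in> {1..m}"
      obtain C where C: "C \<in> comps" "i \<in> C" using ex_comp[OF i] by blast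
      from R C consider (full) "induced_subcomplex \<Delta> C = full_simplex C"
        | (boundary) "induced_subcomplex \<Delta> C = boundary_simplex C" "n i = 2"
        by blast
      then show "cls (Var i :: 'k mpol) \<in> canonical_trace alg"
      proof cases
        case full
        then have face: "C \<in> \<Delta>" by (auto simp: induced_subcomplex_def full_simplex_def)
        \<comment> \<open>The exponent of \<open>x_i\<close> rises from \<open>n i - 1\<close> to
          \<open>n i\<close>, so the pure power kills the product.\<close>
        have "top_exp C + Poly_Mapping.single i 1 \<notin> exps"
          using i C two_le[OF i] finite_face[OF face]
          by (auto simp: exps_def lookup_add lookup_top_exp lookup_single intro!: bexI[of _ i])
        then show ?thesis
          by (rule Var_mem_trace_top[OF C(1) face insert_absorb[OF C(2)]]) (use C(2) in blast)
      next
        case boundary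
        have "C - {i} \<in> boundary_simplex C" using C by (auto simp: boundary_simplex_def)
        then have face: "C - {i} \<in> \<Delta>" unfolding boundary(1)[symmetric]
          by (simp add: induced_subcomplex_def)
        have "C \<notin> induced_subcomplex \<Delta> C" by (simp add: boundary(1) boundary_simplex_def)
        then have "C \<notin> \<Delta>" by (simp add: induced_subcomplex_def)
        \<comment> \<open>Here the product vanishes because its support is the non-face
          \<open>C\<close>.\<close>
        moreover have "Poly_Mapping.keys (top_exp (C - {i}) + Poly_Mapping.single i 1) = C"
          using C by (auto simp: keys_add_nat keys_top_exp[OF face])
        ultimately have "top_exp (C - {i}) + Poly_Mapping.single i 1 \<notin> exps"
          by (simp add: exps_def)
        then show ?thesis
          by (rule Var_mem_trace_top[OF C(1) face insert_Diff[OF C(2)] _ boundary(2)])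
      qed
    qed
  qed
  then show ?thesis by (simp add: nearly_gorenstein_iff_Var)
qed

end
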